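(* Let $E\subset\mathbb{R}^N$ be a set of finite perimeter such that $$\exists\,\xi_0\in\Theta,\ \exists\,\eta>0:\qquad {\xi_0}_{|\partial^*E}\cdot\nu_E\ge\eta\quad\mathcal{H}^{N-1}\text{-a.e. on }\partial^*E.$$ Let $\mathcal{J}_E(\theta)=J((Id+\theta)(E))$ be a shape functional, defined for $\theta$ in a neighborhood of $0$ in $\Theta$, Fréchet differentiable at $\theta=0$, and such that for all small $\theta_1,\theta_2\in\Theta$, $E_{\theta_1}=E_{\theta_2}$ a.e. implies $\mathcal{J}_E(\theta_1)=\mathcal{J}_E(\theta_2)$. Suppose that $\mathcal{J}_E'(0)$ is positive in the sense that for all $\xi\in\Theta$, $$\xi_{|\partial^*E}\cdot\nu_E\ge0\ \ \mathcal{H}^{N-1}\text{-a.e. on }\partial^*E\ \Longrightarrow\ \mathcal{J}_E'(0)\cdot\xi\ge0.$$ Then there exists $k\ge0$ such that $$\forall\,\xi\in\Theta,\qquad|\mathcal{J}_E'(0)\cdot\xi|\le k\,\|\xi_{|\partial^*E}\cdot\nu_E\|_{L^\infty(\partial^*E,\mathcal{H}^{N-1})}.$$ In particular, the distribution $\mathcal{J}_E'(0)$ is of order $0$, that is, a vector-valued measure (supported on $\partial E$).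
   Context: $\Theta$ is the Banach space of $C^1$ maps $\theta:\mathbb{R}^N\to\mathbb{R}^N$ with $\theta$ and $D\theta$ bounded, normed by $\|\theta\|_{1,\infty}=\sup_x|\theta(x)|+\sup_x\|D\theta(x)\|$. For $\theta\in\Theta$, $E_\theta:=(Id+\theta)(E)$. $J$ is a given real-valued function on $\{E_\theta:\theta\in\Theta\text{ small}\}$; $\mathcal{J}_E'(0)$ is the Fréchet derivative of $\mathcal{J}_E$ at $0$, which by restriction to $C_0^\infty(\mathbb{R}^N,\mathbb{R}^N)$ is viewed as an $\mathbb{R}^N$-valued distribution. "$A=B$ a.e." means equality up to a Lebesgue-null set. A measurable set $E$ has finite perimeter if $\nabla\chi_E$ is a bounded $\mathbb{R}^N$-valued measure. Its reduced boundary $\partial^*E$ is the set of $x$ such that $|\nabla\chi_E|(B(x,\rho))>0$ for all $\rho>0$ and $\nu_E(x)=-\lim_{\rho\to0}\frac{\nabla\chi_E(B(x,\rho))}{|\nabla\chi_E|(B(x,\rho))}$ exists with Euclidean norm $1$. $\mathcal{H}^{N-1}$ is the $(N-1)$-dimensional Hausdorff measure. *)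

theory Defs
  imports "HOL-Analysis.Analysis"
begin

section \<open>The space of bounded $C^1$ vector fields with bounded derivative\<close>

definition C1_bounded :: "('a::euclidean_space \<Rightarrow> 'a) set" where
  "C1_bounded = {\<theta>. bounded (range \<theta>) \<and>
     (\<exists>D. (\<forall>x. (\<theta> has_derivative blinfun_apply (D x)) (at x)) \<and>
          continuous_on UNIV D \<and> bounded (range D))}"

lemma C1_bounded_0: "(\<lambda>x. 0) \<in> C1_bounded"
  unfolding C1_bounded_def
  by (auto intro!: exI[of _ "\<lambda>x. 0"] simp: zero_blinfun.rep_eq)

lemma C1_bounded_lincomb:
  assumes "\<theta> \<in> C1_bounded" "\<psi> \<in> C1_bounded"
  shows "(\<lambda>x. a *\<^sub>R \<theta> x + b *\<^sub>R \<psi> x) \<in> C1_bounded"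
proof -
  obtain D where D: "\<And>x. (\<theta> has_derivative blinfun_apply (D x)) (at x)"
      "continuous_on UNIV D" "bounded (range D)" and b1: "bounded (range \<theta>)"
    using assms(1) unfolding C1_bounded_def by auto
  obtain D' where D': "\<And>x. (\<psi> has_derivative blinfun_apply (D' x)) (at x)"
      "continuous_on UNIV D'" "bounded (range D')" and b2: "bounded (range \<psi>)"
    using assms(2) unfolding C1_bounded_def by auto
  let ?D = "\<lambda>x. a *\<^sub>R D x + b *\<^sub>R D' x"
  have "\<forall>x. ((\<lambda>x. a *\<^sub>R \<theta> x + b *\<^sub>R \<psi> x) has_derivative blinfun_apply (?D x)) (at x)"
    using D(1) D'(1)
    by (auto intro!: derivative_eq_intros simp: plus_blinfun.rep_eq scaleR_blinfun.rep_eq)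
  moreover have "continuous_on UNIV ?D"
    by (intro continuous_intros D D')
  moreover have "bounded (range ?D)"
    by (intro bounded_plus_comp bounded_scaleR_comp D D')
  moreover have "bounded (range (\<lambda>x. a *\<^sub>R \<theta> x + b *\<^sub>R \<psi> x))"
    by (intro bounded_plus_comp bounded_scaleR_comp b1 b2)
  ultimately show ?thesis unfolding C1_bounded_def by (intro CollectI conjI exI[of _ ?D])
qed

typedef (overloaded) 'a Theta = "C1_bounded :: ('a::euclidean_space \<Rightarrow> 'a) set"
  morphisms apply_Theta Abs_Theta
  using C1_bounded_0 by blast

setup_lifting type_definition_Theta

lemma Theta_eqI: "(\<And>x. apply_Theta \<theta> x = apply_Theta \<psi> x) \<Longrightarrow> \<theta> = \<psi>"
  by (simp add: apply_Theta_inject[symmetric] ext)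

instantiation Theta :: (euclidean_space) real_vector
begin

lift_definition zero_Theta :: "'a Theta" is "\<lambda>x. 0"
  by (rule C1_bounded_0)

lift_definition plus_Theta :: "'a Theta \<Rightarrow> 'a Theta \<Rightarrow> 'a Theta" is "\<lambda>\<theta> \<psi> x. \<theta> x + \<psi> x"
  using C1_bounded_lincomb[where a=1 and b=1] by simp

lift_definition minus_Theta :: "'a Theta \<Rightarrow> 'a Theta \<Rightarrow> 'a Theta" is "\<lambda>\<theta> \<psi> x. \<theta> x - \<psi> x"
  using C1_bounded_lincomb[where a=1 and b="-1"] by simp

lift_definition uminus_Theta :: "'a Theta \<Rightarrow> 'a Theta" is "\<lambda>\<theta> x. - \<theta> x"
  using C1_bounded_lincomb[where a="-1" and b=0] by force

lift_definition scaleR_Theta :: "real \<Rightarrow> 'a Theta \<Rightarrow> 'a Theta" is "\<lambda>c \<theta> x. c *\<^sub>R \<theta> x"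
  using C1_bounded_lincomb[where b=0] by force

instance
  by standard (transfer; simp add: algebra_simps)+

end

lemmas apply_Theta_simps [simp] =
  zero_Theta.rep_eq plus_Theta.rep_eq minus_Theta.rep_eq uminus_Theta.rep_eq scaleR_Theta.rep_eq

lemma bounded_range_apply_Theta: "bounded (range (apply_Theta \<theta>))"
  using apply_Theta[of \<theta>] unfolding C1_bounded_def by auto

lemma Theta_deriv:
  obtains D where "\<And>x. (apply_Theta \<theta> has_derivative blinfun_apply (D x)) (at x)"
    "continuous_on UNIV D" "bounded (range D)"
    "\<And>x. frechet_derivative (apply_Theta \<theta>) (at x) = blinfun_apply (D x)"
proof -
  obtain D where D: "\<And>x. (apply_Theta \<theta> has_derivative blinfun_apply (D x)) (at x)"
    "continuous_on UNIV D" "bounded (range D)"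
    using apply_Theta[of \<theta>] unfolding C1_bounded_def by auto
  show ?thesis
    using that[OF D] frechet_derivative_at[OF D(1)] by metis
qed

instantiation Theta :: (euclidean_space) real_normed_vector
begin

definition norm_Theta :: "'a Theta \<Rightarrow> real" where
  "norm_Theta \<theta> = (SUP x. norm (apply_Theta \<theta> x)) +
                  (SUP x. onorm (frechet_derivative (apply_Theta \<theta>) (at x)))"

definition dist_Theta :: "'a Theta \<Rightarrow> 'a Theta \<Rightarrow> real" where
  "dist_Theta \<theta> \<psi> = norm (\<theta> - \<psi>)"

definition sgn_Theta :: "'a Theta \<Rightarrow> 'a Theta" where
  "sgn_Theta \<theta> = \<theta> /\<^sub>R norm \<theta>"

definition uniformity_Theta :: "('a Theta \<times> 'a Theta) filter" where
  "uniformity_Theta = (INF e\<in>{0<..}. principal {(\<theta>, \<psi>). dist \<theta> \<psi> < e})"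

definition open_Theta :: "'a Theta set \<Rightarrow> bool" where
  "open_Theta S = (\<forall>\<theta>\<in>S. \<forall>\<^sub>F (\<theta>', \<psi>) in uniformity. \<theta>' = \<theta> \<longrightarrow> \<psi> \<in> S)"

instance
proof
  have bc: "f \<in> bcontfun \<Longrightarrow> norm (Bcontfun f) = (SUP x. norm (f x))"
    for f :: "'a \<Rightarrow> 'c::real_normed_vector"
    by (simp add: norm_bcontfun_def dist_bcontfun.rep_eq Bcontfun_inverse dist_norm)
  have key: "\<exists>f D. norm \<theta> = norm f + norm D \<and> apply_bcontfun f = apply_Theta \<theta> \<and>
       (\<forall>x. (apply_Theta \<theta> has_derivative blinfun_apply (apply_bcontfun D x)) (at x))"
    for \<theta> :: "'a Theta"
  proof -
    obtain D where D: "\<And>x. (apply_Theta \<theta> has_derivative blinfun_apply (D x)) (at x)"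
      "continuous_on UNIV D" "bounded (range D)"
      "\<And>x. frechet_derivative (apply_Theta \<theta>) (at x) = blinfun_apply (D x)"
      using Theta_deriv[of \<theta>] by blast
    have 1: "D \<in> bcontfun" using D by (auto simp: bcontfun_def)
    have "continuous_on UNIV (apply_Theta \<theta>)"
      using D(1) by (auto intro!: continuous_at_imp_continuous_on has_derivative_continuous)
    then have 2: "apply_Theta \<theta> \<in> bcontfun"
      using bounded_range_apply_Theta by (auto simp: bcontfun_def)
    show ?thesis
      by (rule exI[of _ "Bcontfun (apply_Theta \<theta>)"], rule exI[of _ "Bcontfun D"])
         (simp add: bc 1 2 Bcontfun_inverse D norm_Theta_def norm_blinfun.rep_eq)
  qed
  have eqI: "D = D'" if "\<And>x. (f has_derivative blinfun_apply (apply_bcontfun D x)) (at x)"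
     "\<And>x. (f has_derivative blinfun_apply (apply_bcontfun D' x)) (at x)"
   for f :: "'a \<Rightarrow> 'a" and D D'
    by (intro bcontfun_eqI blinfun_eqI) (metis has_derivative_unique that)
  fix \<theta> \<psi> :: "'a Theta" and a :: real
  show "dist \<theta> \<psi> = norm (\<theta> - \<psi>)" by (rule dist_Theta_def)
  show "sgn \<theta> = \<theta> /\<^sub>R norm \<theta>" by (rule sgn_Theta_def)
  show "uniformity = (INF e\<in>{0<..}. principal {(\<theta> :: 'a Theta, \<psi>). dist \<theta> \<psi> < e})"
    by (rule uniformity_Theta_def)
  show "open S = (\<forall>\<theta>\<in>S. \<forall>\<^sub>F (\<theta>', \<psi>) in uniformity. \<theta>' = \<theta> \<longrightarrow> \<psi> \<in> S)" for S :: "'a Theta set"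
    by (rule open_Theta_def)
  obtain f D where f: "norm \<theta> = norm f + norm D" "apply_bcontfun f = apply_Theta \<theta>"
       "\<And>x. (apply_Theta \<theta> has_derivative blinfun_apply (apply_bcontfun D x)) (at x)"
    using key[of \<theta>] by blast
  obtain g D' where g: "norm \<psi> = norm g + norm D'" "apply_bcontfun g = apply_Theta \<psi>"
       "\<And>x. (apply_Theta \<psi> has_derivative blinfun_apply (apply_bcontfun D' x)) (at x)"
    using key[of \<psi>] by blast
  show "norm \<theta> = 0 \<longleftrightarrow> \<theta> = 0"
  proof
    assume "norm \<theta> = 0"
    then have "norm f = 0" using f(1) norm_ge_zero[of f] norm_ge_zero[of D] by linarith
    then show "\<theta> = 0" using f(2) by (intro Theta_eqI) (simp add: fun_eq_iff flip: f(2))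
  next
    assume "\<theta> = 0"
    then have "f = 0" "D = 0" using f(2,3)
      by (auto intro!: bcontfun_eqI[of f] eqI[of "\<lambda>x. 0"] simp: zero_Theta.rep_eq zero_blinfun.rep_eq)
    then show "norm \<theta> = 0" using f(1) by simp
  qed
  show "norm (\<theta> + \<psi>) \<le> norm \<theta> + norm \<psi>"
  proof -
    obtain h H where h: "norm (\<theta> + \<psi>) = norm h + norm H" "apply_bcontfun h = apply_Theta (\<theta> + \<psi>)"
       "\<And>x. (apply_Theta (\<theta> + \<psi>) has_derivative blinfun_apply (apply_bcontfun H x)) (at x)"
      using key[of "\<theta> + \<psi>"] by blast
    have "h = f + g" using h(2) f(2) g(2) by (auto intro!: bcontfun_eqI simp: plus_Theta.rep_eq)
    moreover have "H = D + D'"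
      by (rule eqI[OF h(3)])
         (auto simp: plus_Theta.rep_eq plus_blinfun.rep_eq intro!: has_derivative_add f g)
    ultimately have "norm (\<theta> + \<psi>) = norm (f + g) + norm (D + D')" using h(1) by simp
    also have "\<dots> \<le> (norm f + norm g) + (norm D + norm D')"
      by (intro add_mono norm_triangle_ineq)
    finally show ?thesis using f(1) g(1) by simp
  qed
  show "norm (a *\<^sub>R \<theta>) = \<bar>a\<bar> * norm \<theta>"
  proof -
    obtain h H where h: "norm (a *\<^sub>R \<theta>) = norm h + norm H" "apply_bcontfun h = apply_Theta (a *\<^sub>R \<theta>)"
       "\<And>x. (apply_Theta (a *\<^sub>R \<theta>) has_derivative blinfun_apply (apply_bcontfun H x)) (at x)"
      using key[of "a *\<^sub>R \<theta>"] by blast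
    have "h = a *\<^sub>R f" using h(2) f(2) by (auto intro!: bcontfun_eqI simp: scaleR_Theta.rep_eq)
    moreover have "H = a *\<^sub>R D"
      by (rule eqI[OF h(3)])
         (auto simp: scaleR_Theta.rep_eq scaleR_blinfun.rep_eq intro!: has_derivative_scaleR_right f)
    ultimately show ?thesis using h(1) f(1) by (simp add: distrib_left)
  qed
qed

end

definition deform :: "'a::euclidean_space Theta \<Rightarrow> 'a set \<Rightarrow> 'a set" where
  "deform \<theta> E = (\<lambda>x. x + apply_Theta \<theta> x) ` E"


section \<open>Test fields and distributions\<close>

text \<open>\<open>C_k k f\<close>: all directional derivatives of order at most \<open>k\<close> exist and are continuous; in
  finite dimension this is \<open>C\<^sup>k\<close>.\<close>

primrec C_k :: "nat \<Rightarrow> ('a::real_normed_vector \<Rightarrow> 'b::real_normed_vector) \<Rightarrow> bool" where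
  "C_k 0 f \<longleftrightarrow> continuous_on UNIV f"
| "C_k (Suc k) f \<longleftrightarrow> (\<forall>x. f differentiable (at x)) \<and>
                   (\<forall>v. C_k k (\<lambda>x. frechet_derivative f (at x) v))"

definition test_field :: "('a::euclidean_space \<Rightarrow> 'a) \<Rightarrow> bool" where
  "test_field \<phi> \<longleftrightarrow> (\<forall>k. C_k k \<phi>) \<and> (\<exists>K. compact K \<and> (\<forall>x. x \<notin> K \<longrightarrow> \<phi> x = 0))"

lemma test_field_C1_bounded:
  assumes "test_field \<phi>"
  shows "\<phi> \<in> C1_bounded"
proof -
  obtain K where K: "compact K" "\<And>x. x \<notin> K \<Longrightarrow> \<phi> x = 0"
    using assms by (auto simp: test_field_def)
  have "C_k (Suc 0) \<phi>"
    using assms unfolding test_field_def by blast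
  then have diff: "\<And>x. \<phi> differentiable (at x)"
    and cont: "\<And>v. continuous_on UNIV (\<lambda>x. frechet_derivative \<phi> (at x) v)"
    by auto
  define D where "D x = Blinfun (frechet_derivative \<phi> (at x))" for x
  have D: "blinfun_apply (D x) = frechet_derivative \<phi> (at x)" for x
    unfolding D_def
    by (rule bounded_linear_Blinfun_apply)
       (use diff frechet_derivative_works has_derivative_bounded_linear in blast)
  have der: "(\<phi> has_derivative blinfun_apply (D x)) (at x)" for x
    using diff frechet_derivative_works D by metis
  have cD: "continuous_on UNIV D"
    by (rule continuous_on_blinfun_componentwise) (simp add: D cont)
  have c\<phi>: "continuous_on UNIV \<phi>"
    using der by (auto intro!: continuous_at_imp_continuous_on has_derivative_continuous)
  have D0: "D x = 0" if "x \<notin> K" for x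
  proof -
    have "open (- K)" "x \<in> - K" using K(1) that by (auto simp: compact_imp_closed)
    then have "(\<phi> has_derivative (\<lambda>v. 0)) (at x)"
      by (rule has_derivative_transform_within_open[of "\<lambda>x. 0", rotated]) (auto simp: K(2))
    then have "blinfun_apply (D x) = (\<lambda>v. 0)"
      using der has_derivative_unique by blast
    then show ?thesis by (intro blinfun_eqI) simp
  qed
  have "range D \<subseteq> insert 0 (D ` K)" "range \<phi> \<subseteq> insert 0 (\<phi> ` K)"
    using D0 K(2) by blast+
  moreover have "bounded (insert 0 (D ` K))" "bounded (insert 0 (\<phi> ` K))"
    using K(1) cD c\<phi>
    by (auto intro!: compact_imp_bounded compact_continuous_image intro: continuous_on_subset)
  ultimately have "bounded (range D)" "bounded (range \<phi>)"
    by (meson bounded_subset)+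
  then show ?thesis unfolding C1_bounded_def using der cD by blast
qed

text \<open>Vector-valued distributions are functionals on raw functions, of which only the values
  on test fields matter. By \<open>test_field_C1_bounded\<close>, \<open>restrict_to_test_fields\<close> below restricts
  a functional on \<open>\<Theta>\<close> to all of $C_0^\infty$.\<close>

definition distribution_of_order_0 :: "(('a::euclidean_space \<Rightarrow> 'a) \<Rightarrow> real) \<Rightarrow> bool" where
  "distribution_of_order_0 L \<longleftrightarrow>
     (\<forall>\<phi> \<psi> a b. test_field \<phi> \<longrightarrow> test_field \<psi> \<longrightarrow>
        L (\<lambda>x. a *\<^sub>R \<phi> x + b *\<^sub>R \<psi> x) = a * L \<phi> + b * L \<psi>) \<and>
     (\<forall>K. compact K \<longrightarrow>
        (\<exists>C. \<forall>\<phi>. test_field \<phi> \<longrightarrow> (\<forall>x. x \<notin> K \<longrightarrow> \<phi> x = 0) \<longrightarrow>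
                 \<bar>L \<phi>\<bar> \<le> C * (SUP x. norm (\<phi> x))))"

definition restrict_to_test_fields :: "('a::euclidean_space Theta \<Rightarrow> real) \<Rightarrow> ('a \<Rightarrow> 'a) \<Rightarrow> real" where
  "restrict_to_test_fields T \<phi> = T (Abs_Theta \<phi>)"


section \<open>Hausdorff measure\<close>

text \<open>The case distinction on the empty set only matters for \<^term>\<open>m = 0\<close>, where
  \<^term>\<open>(0::real) ^ 0 = 1\<close> would charge the empty members of a cover. Boundedness is needed
  because \<^const>\<open>diameter\<close> is meaningful for bounded sets only.\<close>

definition hausdorff_pre :: "nat \<Rightarrow> real \<Rightarrow> 'a::metric_space set \<Rightarrow> ennreal" where
  "hausdorff_pre m \<delta> A =
     (INF U\<in>{U :: nat \<Rightarrow> 'a set. A \<subseteq> (\<Union>i. U i) \<and> (\<forall>i. bounded (U i) \<and> diameter (U i) \<le> \<delta>)}.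
        \<Sum>i. if U i = {} then 0 else ennreal (unit_ball_vol (real m) * (diameter (U i) / 2) ^ m))"

definition hausdorff_outer :: "nat \<Rightarrow> 'a::metric_space set \<Rightarrow> ennreal" where
  "hausdorff_outer m A = (SUP \<delta>\<in>{0<..}. hausdorff_pre m \<delta> A)"

definition hausdorff_measure :: "nat \<Rightarrow> 'a::metric_space measure" where
  "hausdorff_measure m =
     measure_of UNIV (lambda_system UNIV UNIV (hausdorff_outer m)) (hausdorff_outer m)"

lemma hausdorff_pre_mono: "A \<subseteq> B \<Longrightarrow> hausdorff_pre m \<delta> A \<le> hausdorff_pre m \<delta> B"
  unfolding hausdorff_pre_def by (rule INF_superset_mono) auto

lemma hausdorff_pre_empty: "0 < \<delta> \<Longrightarrow> hausdorff_pre m \<delta> {} = 0"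
  unfolding hausdorff_pre_def
  by (rule antisym, rule INF_lower2[of "\<lambda>i. {}"]) auto

lemma hausdorff_pre_subadditive:
  "hausdorff_pre m \<delta> (\<Union>n. A n) \<le> (\<Sum>n. hausdorff_pre m \<delta> (A n))"
    (is "?l \<le> (\<Sum>n. ?P n)")
proof (cases "(\<Sum>n. ?P n) = \<infinity>")
  case False
  define w :: "'a set \<Rightarrow> ennreal"
    where "w V = (if V = {} then 0 else ennreal (unit_ball_vol (real m) * (diameter V / 2) ^ m))" for V
  have fin: "?P n < top" for n
    using False sum_le_suminf[OF summableI, of "{n}" ?P] by (auto simp: top_unique less_top)
  show ?thesis
  proof (rule ennreal_le_epsilon)
    fix e :: real assume "0 < e"
    have "\<exists>U. A n \<subseteq> (\<Union>i. U i) \<and> (\<forall>i. bounded (U i) \<and> diameter (U i) \<le> \<delta>) \<and>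
        (\<Sum>i. w (U i)) \<le> ?P n + ennreal (e * (1/2) ^ Suc n)" for n
    proof -
      have "?P n < ?P n + ennreal (e * (1/2) ^ Suc n)"
        using fin[of n] \<open>0 < e\<close> by (auto simp: ennreal_add_left_cancel_less[of _ 0, simplified] ennreal_less_zero_iff)
      then show ?thesis
        unfolding hausdorff_pre_def w_def[symmetric] INF_less_iff by (auto intro: less_imp_le)
    qed
    then obtain U where U: "\<And>n. A n \<subseteq> (\<Union>i. U n i)"
      "\<And>n i. bounded (U n i) \<and> diameter (U n i) \<le> \<delta>"
      "\<And>n. (\<Sum>i. w (U n i)) \<le> ?P n + ennreal (e * (1/2) ^ Suc n)"
      by metis
    define V where "V j = U (fst (prod_decode j)) (snd (prod_decode j))" for j
    have "(\<Union>n. A n) \<subseteq> (\<Union>j. V j)"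
    proof safe
      fix x n assume "x \<in> A n"
      then obtain i where "x \<in> U n i" using U(1) by blast
      then have "x \<in> V (prod_encode (n, i))" by (simp add: V_def)
      then show "x \<in> (\<Union>j. V j)" by blast
    qed
    moreover have "\<forall>j. bounded (V j) \<and> diameter (V j) \<le> \<delta>"
      unfolding V_def using U(2) by blast
    ultimately have "?l \<le> (\<Sum>j. w (V j))"
      unfolding hausdorff_pre_def w_def by (intro INF_lower CollectI conjI)
    also have "\<dots> = (\<Sum>n. \<Sum>i. w (U n i))"
      unfolding V_def
      by (rule suminf_ennreal_2dimen[of _ "\<lambda>p. w (U (fst p) (snd p))"]) simp
    also have "\<dots> \<le> (\<Sum>n. ?P n + ennreal (e * (1/2) ^ Suc n))"
      by (intro suminf_le summableI U)
    also have "\<dots> = (\<Sum>n. ?P n) + (\<Sum>n. ennreal (e * (1/2) ^ Suc n))"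
      by (rule suminf_add[symmetric]) auto
    also have "(\<Sum>n. ennreal (e * (1/2) ^ Suc n)) = ennreal e"
      using sums_mult[OF power_half_series, of e] \<open>0 < e\<close>
      by (intro suminf_ennreal_eq) auto
    finally show "?l \<le> (\<Sum>n. ?P n) + ennreal e" .
  qed
qed simp

lemma outer_measure_space_hausdorff:
  "outer_measure_space UNIV (hausdorff_outer m :: 'a::metric_space set \<Rightarrow> ennreal)"
  unfolding outer_measure_space_def
proof (intro conjI)
  show "positive UNIV (hausdorff_outer m :: 'a set \<Rightarrow> ennreal)"
    unfolding positive_def hausdorff_outer_def
    by (auto simp: hausdorff_pre_empty intro!: antisym SUP_least)
  show "increasing UNIV (hausdorff_outer m :: 'a set \<Rightarrow> ennreal)"
    unfolding increasing_def hausdorff_outer_def by (auto intro!: SUP_mono' hausdorff_pre_mono)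
  show "countably_subadditive UNIV (hausdorff_outer m :: 'a set \<Rightarrow> ennreal)"
    unfolding countably_subadditive_def
  proof safe
    fix A :: "nat \<Rightarrow> 'a set"
    show "hausdorff_outer m (\<Union>n. A n) \<le> (\<Sum>n. hausdorff_outer m (A n))"
      unfolding hausdorff_outer_def[of m "\<Union>n. A n"]
    proof (rule SUP_least)
      fix \<delta> :: real assume "\<delta> \<in> {0<..}"
      then have "hausdorff_pre m \<delta> (A n) \<le> hausdorff_outer m (A n)" for n
        unfolding hausdorff_outer_def by (rule SUP_upper)
      then have "(\<Sum>n. hausdorff_pre m \<delta> (A n)) \<le> (\<Sum>n. hausdorff_outer m (A n))"
        by (intro suminf_le summableI)
      then show "hausdorff_pre m \<delta> (\<Union>n. A n) \<le> (\<Sum>n. hausdorff_outer m (A n))"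
        using hausdorff_pre_subadditive order_trans by blast
    qed
  qed
qed

lemma space_hausdorff_measure [simp]: "space (hausdorff_measure m) = UNIV"
  by (simp add: hausdorff_measure_def space_measure_of_conv)

lemma measure_space_hausdorff:
  "measure_space UNIV (lambda_system UNIV UNIV (hausdorff_outer m))
     (hausdorff_outer m :: 'a::metric_space set \<Rightarrow> ennreal)"
proof -
  interpret sigma_algebra UNIV "UNIV :: 'a set set"
    using sigma_algebra_Pow[of "UNIV :: 'a set"] by simp
  show ?thesis by (rule caratheodory_lemma[OF outer_measure_space_hausdorff])
qed

lemma sets_hausdorff_measure:
  "sets (hausdorff_measure m) =
     lambda_system UNIV UNIV (hausdorff_outer m :: 'a::metric_space set \<Rightarrow> ennreal)"
proof -
  have "sigma_algebra UNIV (lambda_system UNIV UNIV (hausdorff_outer m :: 'a set \<Rightarrow> ennreal))"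
    using measure_space_hausdorff[of m] unfolding measure_space_def by blast
  then show ?thesis
    unfolding hausdorff_measure_def by (simp add: sigma_algebra.sigma_sets_eq)
qed

lemma emeasure_hausdorff_measure:
  fixes A :: "'a::metric_space set"
  assumes "A \<in> sets (hausdorff_measure m)"
  shows "emeasure (hausdorff_measure m) A = hausdorff_outer m A"
  by (rule emeasure_measure_of[OF hausdorff_measure_def _ _ _ assms])
     (use measure_space_hausdorff[where 'a='a, of m] in
       \<open>simp_all add: sets_hausdorff_measure measure_space_def\<close>)

text \<open>Meaningful for essentially bounded functions only: for the others the infimum is taken
  over the empty set.\<close>

definition Linf_norm :: "'a set \<Rightarrow> 'a measure \<Rightarrow> ('a \<Rightarrow> real) \<Rightarrow> real" where
  "Linf_norm A M f = Inf {c. 0 \<le> c \<and> (AE x\<in>A in M. \<bar>f x\<bar> \<le> c)}"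


section \<open>Bounded vector measures\<close>

text \<open>Vector measures are set functions of which only the values on Borel sets matter.\<close>

definition total_variation ::
    "('a::topological_space set \<Rightarrow> 'b::real_normed_vector) \<Rightarrow> 'a set \<Rightarrow> ennreal" where
  "total_variation \<mu> A =
     (SUP P\<in>{P. finite P \<and> disjoint P \<and> P \<subseteq> sets borel \<and> \<Union>P \<subseteq> A}. \<Sum>B\<in>P. ennreal (norm (\<mu> B)))"

definition bounded_vector_measure ::
    "('a::topological_space set \<Rightarrow> 'b::real_normed_vector) \<Rightarrow> bool" where
  "bounded_vector_measure \<mu> \<longleftrightarrow>
     (\<forall>A :: nat \<Rightarrow> 'a set. range A \<subseteq> sets borel \<longrightarrow> disjoint_family A \<longrightarrow>
        (\<lambda>i. \<mu> (A i)) sums \<mu> (\<Union>i. A i)) \<and>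
     total_variation \<mu> UNIV < \<infinity>"

text \<open>Integration against a real-valued measure \<open>\<nu>\<close> uses its Jordan decomposition into
  \<open>pos_variation \<nu>\<close> and \<open>pos_variation (-\<nu>)\<close>.\<close>

definition pos_variation :: "('a::topological_space set \<Rightarrow> real) \<Rightarrow> 'a measure" where
  "pos_variation \<nu> =
     measure_of UNIV (sets borel) (\<lambda>A. SUP B\<in>{B\<in>sets borel. B \<subseteq> A}. ennreal (\<nu> B))"

definition signed_integral :: "('a::topological_space set \<Rightarrow> real) \<Rightarrow> ('a \<Rightarrow> real) \<Rightarrow> real" where
  "signed_integral \<nu> f =
     (LINT x|pos_variation \<nu>. f x) - (LINT x|pos_variation (\<lambda>A. - \<nu> A). f x)"

definition vector_integral :: "('a::topological_space set \<Rightarrow> 'b::euclidean_space) \<Rightarrow> ('a \<Rightarrow> 'b) \<Rightarrow> real" where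
  "vector_integral \<mu> \<xi> = (\<Sum>b\<in>Basis. signed_integral (\<lambda>A. \<mu> A \<bullet> b) (\<lambda>x. \<xi> x \<bullet> b))"

lemma space_pos_variation [simp]: "space (pos_variation \<nu>) = UNIV"
  by (simp add: pos_variation_def space_measure_of_conv)

lemma sets_pos_variation [simp]:
  "sets (pos_variation (\<nu> :: 'a::topological_space set \<Rightarrow> real)) = sets borel"
  using sets.sigma_sets_eq[of "borel :: 'a measure"] by (simp add: pos_variation_def)

lemma emeasure_pos_variation:
  fixes \<nu> :: "'a::topological_space set \<Rightarrow> real"
  assumes "bounded_vector_measure \<nu>" and A: "A \<in> sets borel"
  shows "emeasure (pos_variation \<nu>) A = (SUP B\<in>{B\<in>sets borel. B \<subseteq> A}. ennreal (\<nu> B))"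
proof (rule emeasure_measure_of[OF pos_variation_def])
  have sums: "(\<lambda>i. \<nu> (A i)) sums \<nu> (\<Union>i. A i)"
    if "range A \<subseteq> sets borel" "disjoint_family A" for A :: "nat \<Rightarrow> 'a set"
    using assms(1) that unfolding bounded_vector_measure_def by blast
  have "(\<lambda>i::nat. \<nu> {}) sums \<nu> (\<Union>i::nat. {})"
    by (rule sums) (auto simp: disjoint_family_on_def)
  then have 0: "\<nu> {} = 0" using summable_const_iff[of "\<nu> {}"] by (auto dest: sums_summable)
  have un: "\<nu> (X \<union> Y) = \<nu> X + \<nu> Y" if "X \<in> sets borel" "Y \<in> sets borel" "X \<inter> Y = {}" for X Y
  proof -
    let ?A = "\<lambda>i::nat. if i = 0 then X else if i = 1 then Y else {}"
    have "(\<lambda>i. \<nu> (?A i)) sums \<nu> (\<Union>i. ?A i)"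
      by (rule sums) (use that in \<open>auto simp: disjoint_family_on_def\<close>)
    moreover have "(\<Union>i. ?A i) = X \<union> Y" by (auto split: if_splits)
    moreover have "(\<lambda>i. \<nu> (?A i)) sums (\<Sum>i\<in>{0,1}. \<nu> (?A i))"
      by (rule sums_finite) (auto simp: 0)
    ultimately show ?thesis using sums_unique2 by fastforce
  qed
  let ?p = "\<lambda>A. SUP B\<in>{B\<in>sets borel. B \<subseteq> A}. ennreal (\<nu> B)"
  show "sets borel \<subseteq> Pow (UNIV :: 'a set)" by simp
  have "{B \<in> sets borel. B \<subseteq> ({} :: 'a set)} = {{}}" by auto
  then show "positive (sets (pos_variation \<nu>)) ?p" by (simp add: positive_def 0)
  have sup2: "?p X + ?p Y \<le> ?p (X \<union> Y)" if XY: "X \<in> sets borel" "Y \<in> sets borel" "X \<inter> Y = {}" for X Y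
  proof -
    let ?S = "\<lambda>X :: 'a set. {B \<in> sets borel. B \<subseteq> X}"
    have ne: "?S Z \<noteq> {}" for Z by auto
    have "ennreal (\<nu> B) + ennreal (\<nu> C) \<le> ?p (X \<union> Y)" if "B \<in> ?S X" "C \<in> ?S Y" for B C
    proof -
      define B' where "B' = (if \<nu> B \<le> 0 then {} else B)"
      define C' where "C' = (if \<nu> C \<le> 0 then {} else C)"
      have "ennreal (\<nu> B) = ennreal (\<nu> B')" "ennreal (\<nu> C) = ennreal (\<nu> C')"
           "\<nu> B' \<ge> 0" "\<nu> C' \<ge> 0"
        by (auto simp: B'_def C'_def 0 ennreal_neg)
      moreover have "B' \<in> ?S X" "C' \<in> ?S Y" using that by (auto simp: B'_def C'_def)
      moreover from this have "\<nu> (B' \<union> C') = \<nu> B' + \<nu> C'"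
        using XY by (intro un) auto
      ultimately have "ennreal (\<nu> B) + ennreal (\<nu> C) = ennreal (\<nu> (B' \<union> C'))"
        by simp
      also have "\<dots> \<le> ?p (X \<union> Y)"
        using \<open>B' \<in> ?S X\<close> \<open>C' \<in> ?S Y\<close> by (intro SUP_upper) auto
      finally show ?thesis .
    qed
    then have "(SUP C\<in>?S Y. ennreal (\<nu> B) + ennreal (\<nu> C)) \<le> ?p (X \<union> Y)" if "B \<in> ?S X" for B
      using that by (intro SUP_least) auto
    then have "ennreal (\<nu> B) + ?p Y \<le> ?p (X \<union> Y)" if "B \<in> ?S X" for B
      using that ennreal_SUP_add_right[OF ne[of Y], of "ennreal (\<nu> B)" "\<lambda>C. ennreal (\<nu> C)"]
      by (simp only:)
    then have "(SUP B\<in>?S X. ennreal (\<nu> B) + ?p Y) \<le> ?p (X \<union> Y)"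
      by (intro SUP_least) auto
    then show ?thesis
      using ennreal_SUP_add_left[OF ne[of X], of "\<lambda>B. ennreal (\<nu> B)" "?p Y"] by (simp only:)
  qed
  show "countably_additive (sets (pos_variation \<nu>)) ?p"
    unfolding countably_additive_def
  proof safe
    fix F :: "nat \<Rightarrow> 'a set"
    assume F: "range F \<subseteq> sets (pos_variation \<nu>)" "disjoint_family F"
    then have Fb: "F i \<in> sets borel" for i by auto
    show "(\<Sum>i. ?p (F i)) = ?p (\<Union>i. F i)"
    proof (rule antisym)
      have "(\<Sum>i<n. ?p (F i)) \<le> ?p (\<Union>i<n. F i)" for n
      proof (induction n)
        case 0
        then show ?case by simp
      next
        case (Suc n)
        have "(\<Sum>i<Suc n. ?p (F i)) \<le> ?p (\<Union>i<n. F i) + ?p (F n)"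
          using Suc by (simp add: add_right_mono)
        also have "\<dots> \<le> ?p ((\<Union>i<n. F i) \<union> F n)"
        proof (rule sup2)
          have "F i \<inter> F n = {}" if "i < n" for i
            using F(2) that by (simp add: disjoint_family_on_def)
          then show "(\<Union>i<n. F i) \<inter> F n = {}" by blast
        qed (use Fb in auto)
        also have "(\<Union>i<n. F i) \<union> F n = (\<Union>i<Suc n. F i)" by (auto simp: lessThan_Suc)
        finally show ?case .
      qed
      also have "?p (\<Union>i<n. F i) \<le> ?p (\<Union>i. F i)" for n
        by (rule SUP_subset_mono) auto
      finally show "(\<Sum>i. ?p (F i)) \<le> ?p (\<Union>i. F i)"
        by (rule suminf_le_const[OF summableI])
      show "?p (\<Union>i. F i) \<le> (\<Sum>i. ?p (F i))"
      proof (rule SUP_least, clarify)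
        fix B :: "'a set" assume B: "B \<in> sets borel" "B \<subseteq> (\<Union>i. F i)"
        have "(\<lambda>i. \<nu> (B \<inter> F i)) sums \<nu> (\<Union>i. B \<inter> F i)"
          by (rule sums) (use B(1) Fb F(2) in \<open>auto simp: disjoint_family_on_def\<close>)
        also have "(\<Union>i. B \<inter> F i) = B" using B(2) by auto
        finally have "(\<lambda>n. ennreal (\<Sum>i<n. \<nu> (B \<inter> F i))) \<longlonglongrightarrow> ennreal (\<nu> B)"
          unfolding sums_def by (rule tendsto_ennrealI)
        moreover have "ennreal (\<Sum>i<n. \<nu> (B \<inter> F i)) \<le> (\<Sum>i. ?p (F i))" for n
        proof -
          have "ennreal (\<Sum>i<n. \<nu> (B \<inter> F i)) \<le> ennreal (\<Sum>i<n. max 0 (\<nu> (B \<inter> F i)))"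
            by (intro ennreal_leI sum_mono) auto
          also have "\<dots> = (\<Sum>i<n. ennreal (max 0 (\<nu> (B \<inter> F i))))" by (simp add: sum_ennreal)
          also have "\<dots> \<le> (\<Sum>i<n. ?p (F i))"
          proof (rule sum_mono)
            fix i
            have "ennreal (max 0 (\<nu> (B \<inter> F i))) = ennreal (\<nu> (B \<inter> F i))"
              by (simp add: ennreal_max_0)
            also have "\<dots> \<le> ?p (F i)" using B(1) Fb by (intro SUP_upper) auto
            finally show "ennreal (max 0 (\<nu> (B \<inter> F i))) \<le> ?p (F i)" .
          qed
          also have "\<dots> \<le> (\<Sum>i. ?p (F i))" by (rule sum_le_suminf[OF summableI]) auto
          finally show ?thesis .
        qed
        ultimately show "ennreal (\<nu> B) \<le> (\<Sum>i. ?p (F i))"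
          using LIMSEQ_le_const2 by blast
      qed
    qed
  qed
qed (use A in simp)


section \<open>Sets of finite perimeter and the reduced boundary\<close>

definition divergence :: "('a::euclidean_space \<Rightarrow> 'a) \<Rightarrow> 'a \<Rightarrow> real" where
  "divergence \<phi> x = (\<Sum>b\<in>Basis. frechet_derivative \<phi> (at x) b \<bullet> b)"

text \<open>\<open>\<nabla>\<chi>\<^sub>E = \<mu>\<close> in the sense of distributions.\<close>

definition is_gradient_measure :: "'a::euclidean_space set \<Rightarrow> ('a set \<Rightarrow> 'a) \<Rightarrow> bool" where
  "is_gradient_measure E \<mu> \<longleftrightarrow> bounded_vector_measure \<mu> \<and>
     (\<forall>\<phi>. test_field \<phi> \<longrightarrow> vector_integral \<mu> \<phi> = - (LINT x|lebesgue. indicator E x * divergence \<phi> x))"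

definition finite_perimeter :: "'a::euclidean_space set \<Rightarrow> bool" where
  "finite_perimeter E \<longleftrightarrow> E \<in> sets lebesgue \<and> (\<exists>\<mu>. is_gradient_measure E \<mu>)"

text \<open>The gradient measure is unique on Borel sets, hence the choice does not affect the
  definitions below, which evaluate it on Borel sets only.\<close>

definition gradient_measure :: "'a::euclidean_space set \<Rightarrow> 'a set \<Rightarrow> 'a" where
  "gradient_measure E = (SOME \<mu>. is_gradient_measure E \<mu>)"

definition normal_quotient :: "'a::euclidean_space set \<Rightarrow> 'a \<Rightarrow> real \<Rightarrow> 'a" where
  "normal_quotient E x \<rho> =
     - (gradient_measure E (ball x \<rho>) /\<^sub>R enn2real (total_variation (gradient_measure E) (ball x \<rho>)))"

definition measure_normal :: "'a::euclidean_space set \<Rightarrow> 'a \<Rightarrow> 'a" where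
  "measure_normal E x = Lim (at_right 0) (normal_quotient E x)"

definition reduced_boundary :: "'a::euclidean_space set \<Rightarrow> 'a set" where
  "reduced_boundary E =
     {x. (\<forall>\<rho>>0. total_variation (gradient_measure E) (ball x \<rho>) > 0) \<and>
         (\<exists>\<nu>. norm \<nu> = 1 \<and> (normal_quotient E x \<longlongrightarrow> \<nu>) (at_right 0))}"

end

theory Submission
  imports Defs
begin

text \<open>
  If \<open>\<bar>\<xi> \<cdot> \<nu>\<bar> \<le> c\<close> almost everywhere on the reduced boundary, both fields
  \<open>(c / \<eta>) \<xi>\<^sub>0 \<plusminus> \<xi>\<close> have nonnegative normal component, so positivity gives
  \<open>\<bar>J' \<xi>\<bar> \<le> (c / \<eta>) J' \<xi>\<^sub>0\<close>.

  For the measure, put \<open>\<zeta> = \<xi>\<^sub>0 / \<eta>\<close>. As the normal has norm 1, the fields \<open>\<zeta>\<close> and \<open>\<zeta> - b\<close>, for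
  \<open>b\<close> in the basis, have nonnegative normal component, hence \<open>f \<mapsto> J' (f \<zeta>)\<close> and
  \<open>f \<mapsto> J' (f (\<zeta> - b))\<close> are positive functionals on the bounded \<open>C\<^sup>1\<close> functions. Each is represented
  by a finite measure on compactly supported functions (Daniell--Riesz), and the component of the vector
  measure along \<open>b\<close> is the difference of the two. No Jordan decomposition of the functional is needed.

  If \<open>\<phi>\<close> vanishes on the frontier of \<open>E\<close>, then for small \<open>t\<close> the bijection \<open>Id + t \<phi>\<close> fixes the frontier and,
  by connectedness, maps \<open>E\<close> onto \<open>E\<close>; hence \<open>J' \<phi> = 0\<close>, which puts the measure on the frontier.
\<close>

section \<open>Bounded $C^1$ functions\<close>

text \<open>The conditions of \<open>C1_bounded\<close> with a free codomain: scalar multipliers and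
  vector fields then share their closure lemmas, and products such as
  \<open>f x *\<^sub>R apply_Theta \<zeta> x\<close> can be handled.\<close>

definition C1b :: "('a::real_normed_vector \<Rightarrow> 'b::real_normed_vector) \<Rightarrow> bool" where
  "C1b f \<longleftrightarrow> bounded (range f) \<and>
     (\<exists>D. (\<forall>x. (f has_derivative blinfun_apply (D x)) (at x)) \<and> continuous_on UNIV D \<and> bounded (range D))"

lemma C1bI:
  assumes "bounded (range f)" "\<And>x. (f has_derivative blinfun_apply (D x)) (at x)"
    "continuous_on UNIV D" "bounded (range D)"
  shows "C1b f"
  unfolding C1b_def using assms by auto

lemma C1bE:
  assumes "C1b f"
  obtains D where "\<And>x. (f has_derivative blinfun_apply (D x)) (at x)" "continuous_on UNIV D" "bounded (range D)"
  using assms unfolding C1b_def by auto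

lemma C1b_bounded: "C1b f \<Longrightarrow> bounded (range f)"
  by (simp add: C1b_def)

lemma C1b_continuous: "C1b f \<Longrightarrow> continuous_on UNIV f"
  by (auto simp: C1b_def intro!: continuous_at_imp_continuous_on intro: has_derivative_continuous)

lemma C1b_iff_C1_bounded: "C1b f \<longleftrightarrow> f \<in> C1_bounded"
  by (simp add: C1b_def C1_bounded_def)

lemma C1b_Theta: "C1b (apply_Theta \<theta>)"
  using apply_Theta[of \<theta>] by (simp add: C1b_iff_C1_bounded)

lemma apply_Abs_Theta: "C1b f \<Longrightarrow> apply_Theta (Abs_Theta f) = f"
  by (simp add: Abs_Theta_inverse C1b_iff_C1_bounded)

lemma C1b_const: "C1b (\<lambda>x. c)"
  by (rule C1bI[of _ "\<lambda>x. 0"]) (auto simp: zero_blinfun.rep_eq)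

lemma C1b_add:
  assumes "C1b f" "C1b g"
  shows "C1b (\<lambda>x. f x + g x)"
proof -
  obtain D where D: "\<And>x. (f has_derivative blinfun_apply (D x)) (at x)" "continuous_on UNIV D" "bounded (range D)"
    using C1bE[OF assms(1)] by blast
  obtain D' where D': "\<And>x. (g has_derivative blinfun_apply (D' x)) (at x)" "continuous_on UNIV D'" "bounded (range D')"
    using C1bE[OF assms(2)] by blast
  show ?thesis
  proof (rule C1bI[of _ "\<lambda>x. D x + D' x"])
    show "((\<lambda>x. f x + g x) has_derivative blinfun_apply (D x + D' x)) (at x)" for x
      using has_derivative_add[OF D(1) D'(1)] by (simp add: plus_blinfun.rep_eq)
  qed (intro bounded_plus_comp continuous_intros D D' C1b_bounded assms)+
qed

lemma (in bounded_bilinear) bounded_range: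
  assumes "bounded (range f)" "bounded (range g)"
  shows "bounded (range (\<lambda>x. prod (f x) (g x)))"
proof -
  obtain K where K: "0 < K" "\<And>a b. norm (prod a b) \<le> norm a * norm b * K"
    using pos_bounded by blast
  obtain A where A: "0 < A" "\<And>x. norm (f x) \<le> A" using assms(1) by (auto simp: bounded_pos)
  obtain B where B: "0 < B" "\<And>x. norm (g x) \<le> B" using assms(2) by (auto simp: bounded_pos)
  have "norm (prod (f x) (g x)) \<le> A * B * K" for x
    using K A B by (intro order_trans[OF K(2)] mult_right_mono mult_mono) (auto simp: less_imp_le)
  then show ?thesis by (auto simp: bounded_iff)
qed

text \<open>The partial maps of the product, composed with the derivatives of the factors, give the
  Leibniz derivative as a \<open>blinfun\<close>. An arbitrary bounded bilinear map covers
  multiplication, scaling and inner product at once.\<close>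

lemma (in bounded_bilinear) C1b_prod:
  assumes "C1b f" "C1b g"
  shows "C1b (\<lambda>x. prod (f x) (g x))"
proof -
  obtain D where D: "\<And>x. (f has_derivative blinfun_apply (D x)) (at x)" "continuous_on UNIV D" "bounded (range D)"
    using C1bE[OF assms(1)] by blast
  obtain D' where D': "\<And>x. (g has_derivative blinfun_apply (D' x)) (at x)" "continuous_on UNIV D'" "bounded (range D')"
    using C1bE[OF assms(2)] by blast
  have br: "bounded (range (\<lambda>x. T (h x)))" if "bounded_linear T" "bounded (range h)" for T h
    using bounded_linear_image[OF that(2,1)] by (simp add: image_image)
  show ?thesis
  proof (rule C1bI[of _ "\<lambda>x. (prod_right (f x) o\<^sub>L D' x) + (prod_left (g x) o\<^sub>L D x)"])
    show "((\<lambda>x. prod (f x) (g x)) has_derivative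
        blinfun_apply ((prod_right (f x) o\<^sub>L D' x) + (prod_left (g x) o\<^sub>L D x))) (at x)" for x
      using FDERIV[OF D(1) D'(1)] by (simp add: plus_blinfun.rep_eq)
    show "continuous_on UNIV (\<lambda>x. (prod_right (f x) o\<^sub>L D' x) + (prod_left (g x) o\<^sub>L D x))"
      by (intro continuous_on_add D D' C1b_continuous assms
          bounded_bilinear.continuous_on[OF bounded_bilinear_blinfun_compose]
          bounded_linear.continuous_on[OF bounded_linear_prod_left]
          bounded_linear.continuous_on[OF bounded_linear_prod_right])
    show "bounded (range (\<lambda>x. (prod_right (f x) o\<^sub>L D' x) + (prod_left (g x) o\<^sub>L D x)))"
      by (intro bounded_plus_comp bounded_bilinear.bounded_range[OF bounded_bilinear_blinfun_compose]
          br[OF bounded_linear_prod_left] br[OF bounded_linear_prod_right] D D' C1b_bounded assms)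
  qed (intro bounded_range C1b_bounded assms)
qed

lemmas C1b_mult = bounded_bilinear.C1b_prod[OF bounded_bilinear_mult]
lemmas C1b_scaleR = bounded_bilinear.C1b_prod[OF bounded_bilinear_scaleR]
lemmas C1b_inner = bounded_bilinear.C1b_prod[OF bounded_bilinear_inner]

text \<open>Bounded C^1 functions are not closed under min and max, so the lattice operations of
  Daniell's construction are replaced by this reciprocal, from which approximations of indicators
  are built. Since 1 + f is at least 1, the factor 1 / (1 + f)^2 of the derivative is at most
  1.\<close>

lemma C1b_inverse:
  fixes f :: "'a::real_normed_vector \<Rightarrow> real"
  assumes f: "C1b f" and f0: "\<And>x. 0 \<le> f x"
  shows "C1b (\<lambda>x. 1 / (1 + f x))"
proof -
  obtain D where D: "\<And>x. (f has_derivative blinfun_apply (D x)) (at x)" "continuous_on UNIV D" "bounded (range D)"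
    using C1bE[OF f] by blast
  have pos: "0 < 1 + f x" for x using f0[of x] by linarith
  have ne: "1 + f x \<noteq> 0" for x using pos[of x] by linarith
  have le1: "1 / (1 + f x) \<le> 1" "0 \<le> 1 / (1 + f x)" for x
    using f0[of x] pos[of x] by auto
  show ?thesis
  proof (rule C1bI[of _ "\<lambda>x. (- ((1 / (1 + f x)) * (1 / (1 + f x)))) *\<^sub>R D x"])
    show "bounded (range (\<lambda>x. 1 / (1 + f x)))"
      using le1 by (intro boundedI[of _ 1]) auto
    show "((\<lambda>x. 1 / (1 + f x)) has_derivative
        blinfun_apply ((- ((1 / (1 + f x)) * (1 / (1 + f x)))) *\<^sub>R D x)) (at x)" for x
      using ne[of x]
      by (auto intro!: derivative_eq_intros D(1) simp: scaleR_blinfun.rep_eq uminus_blinfun.rep_eq fun_eq_iff field_simps)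
    show "continuous_on UNIV (\<lambda>x. (- ((1 / (1 + f x)) * (1 / (1 + f x)))) *\<^sub>R D x)"
      using ne by (intro continuous_intros D C1b_continuous f) auto
    have "\<bar>- ((1 / (1 + f x)) * (1 / (1 + f x)))\<bar> \<le> 1" for x
      by (simp only: abs_minus_cancel abs_mult abs_of_nonneg[OF le1(2)]
          mult_le_one[OF le1(1) le1(2) le1(1)])
    then have "bounded (range (\<lambda>x. - ((1 / (1 + f x)) * (1 / (1 + f x)))))"
      unfolding bounded_iff real_norm_def by (intro exI[of _ 1] ballI) (elim rangeE, simp only:)
    then show "bounded (range (\<lambda>x. (- ((1 / (1 + f x)) * (1 / (1 + f x)))) *\<^sub>R D x))"
      by (rule bounded_bilinear.bounded_range[OF bounded_bilinear_scaleR _ D(3)])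
  qed
qed

section \<open>Compactly supported C^1 bump functions\<close>

text \<open>The positive part alone has a corner on the sphere of radius r; the outer square smooths
  it to a C^1 function.\<close>

definition bump :: "'a::euclidean_space \<Rightarrow> real \<Rightarrow> 'a \<Rightarrow> real" where
  "bump a r x = (max 0 (r\<^sup>2 - (x - a) \<bullet> (x - a)))\<^sup>2"

lemma bump_nonneg: "0 \<le> bump a r x"
  by (simp add: bump_def)

lemma square_le_inner:
  assumes "x \<notin> ball a r" "0 < r"
  shows "r\<^sup>2 \<le> (x - a) \<bullet> (x - a)"
proof -
  have "r \<le> norm (x - a)" using assms by (simp add: dist_norm norm_minus_commute)
  with assms(2) show ?thesis by (simp add: power_mono flip: power2_norm_eq_inner)
qed

lemma bump_eq_0: "x \<notin> ball a r \<Longrightarrow> 0 < r \<Longrightarrow> bump a r x = 0"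
  using square_le_inner[of x a r] by (simp add: bump_def max_def)

lemma has_derivative_max_square: "((\<lambda>t::real. (max 0 t)\<^sup>2) has_real_derivative 2 * max 0 t) (at t)"
proof -
  consider "t < 0" | "t = 0" | "0 < t" by linarith
  then show ?thesis
  proof cases
    case 1
    have "((\<lambda>t::real. 0) has_real_derivative 0) (at t)" by simp
    then have "((\<lambda>t::real. (max 0 t)\<^sup>2) has_real_derivative 0) (at t)"
      by (rule has_field_derivative_transform_within_open[of _ _ _ "{..<0}"]) (use 1 in auto)
    then show ?thesis using 1 by simp
  next
    case 3
    have "((\<lambda>t::real. t\<^sup>2) has_real_derivative 2 * t) (at t)"
      by (auto intro!: derivative_eq_intros)
    then have "((\<lambda>t::real. (max 0 t)\<^sup>2) has_real_derivative 2 * t) (at t)"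
      by (rule has_field_derivative_transform_within_open[of _ _ _ "{0<..}"]) (use 3 in auto)
    then show ?thesis using 3 by simp
  next
    case 2
    \<comment> \<open>At the former corner the difference quotient is at most |h| in size.\<close>
    have "((\<lambda>h::real. (max 0 h)\<^sup>2 / h) \<longlongrightarrow> 0) (at 0)"
    proof (rule Lim_null_comparison)
      show "\<forall>\<^sub>F h in at (0::real). norm ((max 0 h)\<^sup>2 / h) \<le> \<bar>h\<bar>"
        by (rule always_eventually) (auto simp: max_def power2_eq_square)
      show "((\<lambda>h::real. \<bar>h\<bar>) \<longlongrightarrow> 0) (at 0)" by (auto intro!: tendsto_eq_intros)
    qed
    then show ?thesis using 2 by (simp add: DERIV_def)
  qed
qed

lemma bounded_range_of_compact_support:
  fixes f :: "'a::topological_space \<Rightarrow> 'b::real_normed_vector"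
  assumes "continuous_on UNIV f" "compact K" "\<And>x. x \<notin> K \<Longrightarrow> f x = 0"
  shows "bounded (range f)"
proof -
  have "bounded (insert 0 (f ` K))"
    using assms by (auto intro!: compact_imp_bounded compact_continuous_image intro: continuous_on_subset)
  moreover have "range f \<subseteq> insert 0 (f ` K)" using assms(3) by blast
  ultimately show ?thesis by (rule bounded_subset)
qed

lemma C1b_bump:
  assumes "0 < r"
  shows "C1b (bump a r)"
proof -
  let ?q = "\<lambda>x. r\<^sup>2 - (x - a) \<bullet> (x - a)"
  \<comment> \<open>Chain rule: twice the positive part times the gradient -2 (x - a) of
    \<open>?q\<close>. Like the bump it vanishes off \<open>cball a r\<close>, and compactness of
    this ball gives boundedness.\<close>
  let ?D = "\<lambda>x. (2 * max 0 (?q x)) *\<^sub>R blinfun_inner_right ((- 2) *\<^sub>R (x - a))"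
  have qneg: "?q x \<le> 0" if "x \<notin> ball a r" for x
    using square_le_inner[OF that assms] by simp
  have out: "bump a r x = 0" "?D x = 0" if "x \<notin> cball a r" for x
    using qneg[of x] that by (auto simp: bump_def max_def)
  have der: "(bump a r has_derivative blinfun_apply (?D x)) (at x)" for x
  proof -
    have q: "(?q has_derivative (\<lambda>v. ((- 2) *\<^sub>R (x - a)) \<bullet> v)) (at x)"
      by (auto intro!: derivative_eq_intros simp: inner_commute algebra_simps)
    have "((\<lambda>x. (max 0 (?q x))\<^sup>2) has_derivative
        (\<lambda>v. (2 * max 0 (?q x)) * (((- 2) *\<^sub>R (x - a)) \<bullet> v))) (at x)"
      using has_derivative_compose[OF q has_derivative_max_square[unfolded has_field_derivative_def]]
      by simp
    then show ?thesis
      by (simp add: bump_def[abs_def] scaleR_blinfun.rep_eq)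
  qed
  have cont: "continuous_on UNIV ?D"
    by (intro continuous_intros continuous_on_scaleR bounded_linear.continuous_on[OF bounded_linear_blinfun_inner_right])
  have contb: "continuous_on UNIV (bump a r)"
    unfolding bump_def by (intro continuous_intros)
  show ?thesis
    by (rule C1bI[OF bounded_range_of_compact_support[OF contb compact_cball out(1)] der cont
          bounded_range_of_compact_support[OF cont compact_cball out(2)]])
qed

section \<open>Deformations fixing the frontier\<close>

text \<open>For |s| at most |t| the map Id + s phi is injective, as s phi is a contraction, and it
  fixes the frontier pointwise. The path from x to x + t phi(x) therefore never crosses the
  frontier, and the contraction principle supplies preimages.\<close>

lemma eq_on_frontier_perturbation:
  fixes \<phi> :: "'a::euclidean_space \<Rightarrow> 'a"
  assumes lip: "\<And>x y. norm (\<phi> x - \<phi> y) \<le> B * norm (x - y)" and B: "0 \<le> B" "\<bar>t\<bar> * B < 1"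
    and zero: "\<And>x. x \<in> frontier E \<Longrightarrow> \<phi> x = 0"
  shows "(\<lambda>x. x + t *\<^sub>R \<phi> x) ` E = E"
proof -
  have lip': "norm (s *\<^sub>R \<phi> x - s *\<^sub>R \<phi> y) \<le> (\<bar>t\<bar> * B) * norm (x - y)" if "\<bar>s\<bar> \<le> \<bar>t\<bar>" for s x y
  proof -
    have "norm (s *\<^sub>R \<phi> x - s *\<^sub>R \<phi> y) = \<bar>s\<bar> * norm (\<phi> x - \<phi> y)"
      by (simp flip: scaleR_diff_right)
    also have "\<dots> \<le> \<bar>t\<bar> * (B * norm (x - y))"
      using that B by (intro mult_mono lip) auto
    finally show ?thesis by (simp add: mult.assoc)
  qed
  have inj: "x = y" if "x + s *\<^sub>R \<phi> x = y + s *\<^sub>R \<phi> y" "\<bar>s\<bar> \<le> \<bar>t\<bar>" for s x y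
  proof -
    have "x - y = s *\<^sub>R \<phi> y - s *\<^sub>R \<phi> x" using that(1) by (simp add: algebra_simps)
    then have "norm (x - y) \<le> (\<bar>t\<bar> * B) * norm (x - y)"
      using lip'[OF that(2), of y x] by (simp add: norm_minus_commute)
    then have "(1 - \<bar>t\<bar> * B) * norm (x - y) \<le> 0" by (simp add: algebra_simps)
    then have "norm (x - y) \<le> 0" using B(2) by (simp add: mult_le_0_iff)
    then show ?thesis by simp
  qed
  have inE: "x + t *\<^sub>R \<phi> x \<in> E \<longleftrightarrow> x \<in> E" for x
  proof (cases "x \<in> frontier E")
    case False
    define C where "C = (\<lambda>s. x + s *\<^sub>R \<phi> x) ` closed_segment 0 t"
    have conn: "connected C"
      unfolding C_def by (intro connected_continuous_image continuous_intros connected_segment)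
    have disj: "C \<inter> frontier E = {}"
    proof (rule ccontr)
      assume "C \<inter> frontier E \<noteq> {}"
      then obtain s where s: "s \<in> closed_segment 0 t" "x + s *\<^sub>R \<phi> x \<in> frontier E"
        by (auto simp: C_def)
      have le: "\<bar>s\<bar> \<le> \<bar>t\<bar>" using s(1) by (auto simp: closed_segment_eq_real_ivl split: if_splits)
      \<comment> \<open>A frontier point on the path is fixed by Id + s phi and is also the image of
        x under this map; injectivity forces it to be x.\<close>
      have fix_pt: "(x + s *\<^sub>R \<phi> x) + s *\<^sub>R \<phi> (x + s *\<^sub>R \<phi> x) = x + s *\<^sub>R \<phi> x"
        using zero[OF s(2)] by simp
      have "x + s *\<^sub>R \<phi> x = x" by (rule inj[OF fix_pt le])
      with s(2) have "x \<in> frontier E" by (simp only:)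
      with False show False by contradiction
    qed
    have "x \<in> C" unfolding C_def by (rule image_eqI[of _ _ 0]) auto
    moreover have "x + t *\<^sub>R \<phi> x \<in> C" unfolding C_def by (intro imageI ends_in_segment)
    moreover have "C \<inter> E = {} \<or> C - E = {}"
      using connected_Int_frontier[OF conn, of E] disj by metis
    ultimately show ?thesis by blast
  qed (simp add: zero)
  have "\<exists>x. x + t *\<^sub>R \<phi> x = y" for y
  proof -
    \<comment> \<open>A preimage of y is a fixed point of the contraction sending x to y - t
      phi(x).\<close>
    have "\<exists>!x. y - t *\<^sub>R \<phi> x = x"
    proof (rule banach_fix_type[of "\<bar>t\<bar> * B"])
      show "\<forall>x z. dist (y - t *\<^sub>R \<phi> x) (y - t *\<^sub>R \<phi> z) \<le> (\<bar>t\<bar> * B) * dist x z"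
        using lip'[of t] by (simp add: dist_norm norm_minus_commute)
    qed (use B in auto)
    then obtain x where "y - t *\<^sub>R \<phi> x = x" by (rule ex1E)
    then show ?thesis by (intro exI[of _ x]) (simp add: algebra_simps)
  qed
  then have surj: "\<forall>y. \<exists>x. x + t *\<^sub>R \<phi> x = y" by (rule allI)
  show ?thesis
  proof (rule set_eqI, rule iffI)
    fix y assume "y \<in> E"
    moreover obtain x where "x + t *\<^sub>R \<phi> x = y" using surj by (elim allE exE)
    ultimately show "y \<in> (\<lambda>x. x + t *\<^sub>R \<phi> x) ` E" using inE[of x] by (intro image_eqI[of _ _ x]) simp_all
  next
    fix y assume "y \<in> (\<lambda>x. x + t *\<^sub>R \<phi> x) ` E"
    then obtain x where "x \<in> E" "y = x + t *\<^sub>R \<phi> x" by (rule imageE)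
    then show "y \<in> E" using inE[of x] by simp
  qed
qed

text \<open>Along the ray spanned by phi the deformed set is E itself for |t| < 1 / B, where B
  bounds the derivative of phi. The functional is constant there, so its derivative in the direction
  phi vanishes.\<close>

lemma shape_derivative_eq_0:
  fixes J :: "'a::euclidean_space set \<Rightarrow> real"
  assumes J': "((\<lambda>\<theta>. J (deform \<theta> E)) has_derivative J') (at 0)"
    and zero: "\<And>x. x \<in> frontier E \<Longrightarrow> apply_Theta \<phi> x = 0"
  shows "J' \<phi> = 0"
proof -
  obtain D where D: "\<And>x. (apply_Theta \<phi> has_derivative blinfun_apply (D x)) (at x)" "bounded (range D)"
    using C1bE[OF C1b_Theta[of \<phi>]] by blast
  obtain B where B: "0 < B" "\<And>x. norm (D x) \<le> B" using D(2) by (auto simp: bounded_pos)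
  have lip: "norm (apply_Theta \<phi> x - apply_Theta \<phi> y) \<le> B * norm (x - y)" for x y
    by (rule differentiable_bound[of UNIV _ "\<lambda>x. blinfun_apply (D x)"])
       (use B D in \<open>auto simp: norm_blinfun.rep_eq[symmetric]\<close>)
  have const: "J (deform (t *\<^sub>R \<phi>) E) = J E" if "\<bar>t\<bar> < 1 / B" for t
  proof -
    have "\<bar>t\<bar> * B < 1" using that B by (simp add: field_simps)
    then have "deform (t *\<^sub>R \<phi>) E = E"
      using eq_on_frontier_perturbation[OF lip _ _ zero] B
      by (simp add: deform_def)
    then show ?thesis by simp
  qed
  have lin: "((\<lambda>t::real. t *\<^sub>R \<phi>) has_derivative (\<lambda>t. t *\<^sub>R \<phi>)) (at 0)"
    by (auto intro!: derivative_eq_intros)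
  have "((\<lambda>t::real. J (deform (t *\<^sub>R \<phi>) E)) has_derivative (\<lambda>t. J' (t *\<^sub>R \<phi>))) (at 0)"
    by (rule has_derivative_compose[OF lin]) (use J' in simp)
  moreover have "((\<lambda>t::real. J (deform (t *\<^sub>R \<phi>) E)) has_derivative (\<lambda>t. 0)) (at 0)"
    by (rule has_derivative_transform_within_open[of "\<lambda>t. J E" _ _ _ "ball 0 (1 / B)"])
       (use B const in \<open>auto simp: dist_norm\<close>)
  ultimately have "(\<lambda>t. J' (t *\<^sub>R \<phi>)) = (\<lambda>t. 0)" by (rule has_derivative_unique)
  from fun_cong[OF this, of 1] show ?thesis by simp
qed

section \<open>The Daniell--Riesz representation of positive functionals\<close>

text \<open>The domain is an algebra, not a vector lattice: closure under 1 / (1 + f) replaces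
  truncation, and \<open>S_separates\<close> makes the sets where members of \<open>S\<close> are
  positive a base of the topology. Constants belong to \<open>S\<close>, so
  \<open>P (\<lambda>x. 1)\<close> bounds the total mass.\<close>

locale positive_functional =
  fixes S :: "('a::second_countable_topology \<Rightarrow> real) set" and P :: "('a \<Rightarrow> real) \<Rightarrow> real"
  assumes S_const: "(\<lambda>x. c) \<in> S"
    and S_add: "f \<in> S \<Longrightarrow> g \<in> S \<Longrightarrow> (\<lambda>x. f x + g x) \<in> S"
    and S_mult: "f \<in> S \<Longrightarrow> g \<in> S \<Longrightarrow> (\<lambda>x. f x * g x) \<in> S"
    and S_inverse: "f \<in> S \<Longrightarrow> (\<And>x. 0 \<le> f x) \<Longrightarrow> (\<lambda>x. 1 / (1 + f x)) \<in> S"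
    and S_continuous: "f \<in> S \<Longrightarrow> continuous_on UNIV f"
    and S_separates: "open U \<Longrightarrow> x \<in> U \<Longrightarrow>
          \<exists>h\<in>S. (\<forall>y. 0 \<le> h y) \<and> 0 < h x \<and> (\<forall>y. y \<notin> U \<longrightarrow> h y = 0)"
    and P_add: "f \<in> S \<Longrightarrow> g \<in> S \<Longrightarrow> P (\<lambda>x. f x + g x) = P f + P g"
    and P_scale: "f \<in> S \<Longrightarrow> P (\<lambda>x. c * f x) = c * P f"
    and P_nonneg: "f \<in> S \<Longrightarrow> (\<And>x. 0 \<le> f x) \<Longrightarrow> 0 \<le> P f"
begin

definition S_nonneg :: "('a \<Rightarrow> real) set" where
  "S_nonneg = {f \<in> S. \<forall>x. 0 \<le> f x}"

text \<open>Daniell's upper integral. With values in \<open>ennreal\<close>, covers of infinite cost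
  and divergent series need no side conditions.\<close>

definition upper :: "('a \<Rightarrow> ennreal) \<Rightarrow> ennreal" where
  "upper h = (INF f\<in>{f :: nat \<Rightarrow> 'a \<Rightarrow> real. range f \<subseteq> S_nonneg \<and> (\<forall>x. h x \<le> (\<Sum>n. ennreal (f n x)))}.
                \<Sum>n. ennreal (P (f n)))"

lemma S_scale: "f \<in> S \<Longrightarrow> (\<lambda>x. c * f x) \<in> S"
  using S_mult[OF S_const] by auto

lemma S_diff: "f \<in> S \<Longrightarrow> g \<in> S \<Longrightarrow> (\<lambda>x. f x - g x) \<in> S"
  using S_add[of f "\<lambda>x. (-1) * g x"] S_scale[of g "-1"] by simp

lemma P_diff: "f \<in> S \<Longrightarrow> g \<in> S \<Longrightarrow> P (\<lambda>x. f x - g x) = P f - P g"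
  using P_add[of f "\<lambda>x. (-1) * g x"] S_scale[of g "-1"] P_scale[of g "-1"] by simp

lemma P_mono: "f \<in> S \<Longrightarrow> g \<in> S \<Longrightarrow> (\<And>x. f x \<le> g x) \<Longrightarrow> P f \<le> P g"
  using P_nonneg[OF S_diff[of g f]] P_diff[of g f] by simp

lemma P_0: "P (\<lambda>x. 0) = 0"
  using P_scale[OF S_const[of 0], of 0] by simp

lemma S_sum: "finite A \<Longrightarrow> (\<And>i. i \<in> A \<Longrightarrow> f i \<in> S) \<Longrightarrow> (\<lambda>x. \<Sum>i\<in>A. f i x) \<in> S"
  by (induction A rule: finite_induct) (auto intro: S_add S_const)

lemma P_sum: "finite A \<Longrightarrow> (\<And>i. i \<in> A \<Longrightarrow> f i \<in> S) \<Longrightarrow> P (\<lambda>x. \<Sum>i\<in>A. f i x) = (\<Sum>i\<in>A. P (f i))"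
  by (induction A rule: finite_induct) (auto simp: P_0 P_add S_sum)

lemma S_nonneg_S: "f \<in> S_nonneg \<Longrightarrow> f \<in> S" and S_nonneg_ge_0: "f \<in> S_nonneg \<Longrightarrow> 0 \<le> f x"
  by (auto simp: S_nonneg_def)

lemma S_nonneg_mult: "f \<in> S_nonneg \<Longrightarrow> g \<in> S_nonneg \<Longrightarrow> (\<lambda>x. f x * g x) \<in> S_nonneg"
  by (auto simp: S_nonneg_def S_mult)

lemma P_S_nonneg: "f \<in> S_nonneg \<Longrightarrow> 0 \<le> P f"
  by (auto simp: S_nonneg_def P_nonneg)

lemma upper_le:
  assumes "\<And>n. f n \<in> S_nonneg" "\<And>x. h x \<le> (\<Sum>n. ennreal (f n x))"
  shows "upper h \<le> (\<Sum>n. ennreal (P (f n)))"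
  unfolding upper_def using assms by (intro INF_lower) auto

lemma upper_le1:
  assumes "g \<in> S_nonneg" "\<And>x. h x \<le> ennreal (g x)"
  shows "upper h \<le> ennreal (P g)"
proof -
  let ?f = "\<lambda>n::nat. if n = 0 then g else (\<lambda>x. 0)"
  have s: "(\<Sum>n. ennreal (?f n x)) = ennreal (g x)" for x
    using suminf_finite[of "{0}" "\<lambda>n. ennreal (?f n x)"] by simp
  have "(\<Sum>n. ennreal (P (?f n))) = ennreal (P g)"
    using suminf_finite[of "{0}" "\<lambda>n. ennreal (P (?f n))"] by (simp add: P_0)
  moreover have "?f n \<in> S_nonneg" for n using assms(1) S_const by (auto simp: S_nonneg_def)
  ultimately show ?thesis using upper_le[of ?f h] assms(2) s by simp
qed

lemma upper_mono: "(\<And>x. h x \<le> k x) \<Longrightarrow> upper h \<le> upper k"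
  unfolding upper_def by (intro INF_superset_mono order_refl) (auto, meson order_trans)

lemma upper_0: "upper (\<lambda>x. 0) = 0"
  using upper_le1[of "\<lambda>x. 0" "\<lambda>x. 0"] S_const by (simp add: S_nonneg_def P_0)

lemma upper_countably_subadditive: "upper (\<lambda>x. \<Sum>i. h i x) \<le> (\<Sum>i. upper (h i))"
proof (cases "(\<Sum>i. upper (h i)) = \<infinity>")
  case False
  have fin: "upper (h i) < top" for i
    using False sum_le_suminf[OF summableI, of "{i}" "\<lambda>i. upper (h i)"]
    by (auto simp: top_unique less_top)
  show ?thesis
  proof (rule ennreal_le_epsilon)
    fix e :: real assume "0 < e"
    \<comment> \<open>Near-optimal covers with errors summing to e; finiteness of
      \<open>upper (h i)\<close> makes the strict inequality available.\<close>
    have "\<exists>f. range f \<subseteq> S_nonneg \<and> (\<forall>x. h i x \<le> (\<Sum>n. ennreal (f n x))) \<and>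
        (\<Sum>n. ennreal (P (f n))) \<le> upper (h i) + ennreal (e * (1/2) ^ Suc i)" for i
    proof -
      have "upper (h i) < upper (h i) + ennreal (e * (1/2) ^ Suc i)"
        using fin[of i] \<open>0 < e\<close>
        by (auto simp: ennreal_add_left_cancel_less[of _ 0, simplified] ennreal_less_zero_iff)
      then show ?thesis
        unfolding upper_def[of "h i"] INF_less_iff by (auto intro: less_imp_le)
    qed
    then obtain f where f: "\<And>i. range (f i) \<subseteq> S_nonneg" "\<And>i x. h i x \<le> (\<Sum>n. ennreal (f i n x))"
      "\<And>i. (\<Sum>n. ennreal (P (f i n))) \<le> upper (h i) + ennreal (e * (1/2) ^ Suc i)"
      by metis
    \<comment> \<open>Pairing of indices turns the double family of covers into one
      sequence.\<close>
    define F where "F j = f (fst (prod_decode j)) (snd (prod_decode j))" for j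
    have "upper (\<lambda>x. \<Sum>i. h i x) \<le> (\<Sum>j. ennreal (P (F j)))"
    proof (rule upper_le)
      show "F n \<in> S_nonneg" for n using f(1) by (auto simp: F_def)
      fix x
      have "(\<Sum>i. h i x) \<le> (\<Sum>i. \<Sum>n. ennreal (f i n x))"
        by (intro suminf_le summableI f)
      also have "\<dots> = (\<Sum>j. ennreal (F j x))"
        unfolding F_def
        by (rule suminf_ennreal_2dimen[of _ "\<lambda>p. ennreal (f (fst p) (snd p) x)", symmetric]) simp
      finally show "(\<Sum>i. h i x) \<le> (\<Sum>j. ennreal (F j x))" .
    qed
    also have "\<dots> = (\<Sum>i. \<Sum>n. ennreal (P (f i n)))"
      unfolding F_def
      by (rule suminf_ennreal_2dimen[of _ "\<lambda>p. ennreal (P (f (fst p) (snd p)))"]) simp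
    also have "\<dots> \<le> (\<Sum>i. upper (h i) + ennreal (e * (1/2) ^ Suc i))"
      by (intro suminf_le summableI f)
    also have "\<dots> = (\<Sum>i. upper (h i)) + (\<Sum>i. ennreal (e * (1/2) ^ Suc i))"
      by (rule suminf_add[symmetric]) auto
    also have "(\<Sum>i. ennreal (e * (1/2) ^ Suc i)) = ennreal e"
      using sums_mult[OF power_half_series, of e] \<open>0 < e\<close>
      by (intro suminf_ennreal_eq) auto
    finally show "upper (\<lambda>x. \<Sum>i. h i x) \<le> (\<Sum>i. upper (h i)) + ennreal e" .
  qed
qed simp

lemma upper_scale:
  assumes "0 < c"
  shows "upper (\<lambda>x. ennreal c * h x) = ennreal c * upper h"
proof -
  have inv: "ennreal c * (ennreal (1/c) * y) = y" "ennreal (1/c) * (ennreal c * y) = y"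
    if "0 < c" for c y
    using that by (simp_all flip: mult.assoc ennreal_mult')
  \<comment> \<open>One inequality for all positive constants suffices: with 1/c in place of c it
    yields the reverse one.\<close>
  have le: "ennreal (1/c) * upper (\<lambda>x. ennreal c * h x) \<le> upper h" if c: "0 < c" for c h
    unfolding upper_def[of h]
  proof (rule INF_greatest, clarify)
    fix f assume f: "range f \<subseteq> S_nonneg" "\<forall>x. h x \<le> (\<Sum>n. ennreal (f n x))"
    then have fN: "f n \<in> S_nonneg" for n by auto
    have "upper (\<lambda>x. ennreal c * h x) \<le> (\<Sum>n. ennreal (P (\<lambda>x. c * f n x)))"
    proof (rule upper_le)
      show "(\<lambda>x. c * f n x) \<in> S_nonneg" for n
        using fN c by (auto simp: S_nonneg_def S_scale)
      show "ennreal c * h x \<le> (\<Sum>n. ennreal (c * f n x))" for x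
        using f c by (auto simp: ennreal_mult' intro!: mult_left_mono)
    qed
    also have "\<dots> = ennreal c * (\<Sum>n. ennreal (P (f n)))"
      using c fN by (simp add: P_scale S_nonneg_S ennreal_mult')
    finally have "ennreal (1/c) * upper (\<lambda>x. ennreal c * h x)
        \<le> ennreal (1/c) * (ennreal c * (\<Sum>n. ennreal (P (f n))))"
      by (rule mult_left_mono) simp
    then show "ennreal (1/c) * upper (\<lambda>x. ennreal c * h x) \<le> (\<Sum>n. ennreal (P (f n)))"
      by (simp only: inv c)
  qed
  show ?thesis
  proof (rule antisym)
    have "ennreal c * (ennreal (1/c) * upper (\<lambda>x. ennreal c * h x)) \<le> ennreal c * upper h"
      by (rule mult_left_mono[OF le[OF assms]]) simp
    then show "upper (\<lambda>x. ennreal c * h x) \<le> ennreal c * upper h"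
      by (simp only: inv assms)
    show "ennreal c * upper h \<le> upper (\<lambda>x. ennreal c * h x)"
      using le[of "1/c" "\<lambda>x. ennreal c * h x"] assms by (simp add: inv)
  qed
qed

text \<open>The functions \<open>1 - 1 / (1 + k g)\<close> increase to the indicator of the set \<open>g > 0\<close>.\<close>

lemma upper_split:
  assumes g: "g \<in> S_nonneg"
  shows "upper (\<lambda>x. h x * indicator {x. 0 < g x} x) + upper (\<lambda>x. h x * indicator {x. \<not> 0 < g x} x)
         \<le> upper h" (is "?a + ?b \<le> _")
proof -
  define G where "G k x = 1 - 1 / (1 + real k * g x)" for k x
  \<comment> \<open>As \<open>G 0\<close> is zero, the increments telescope to \<open>G K\<close>,
    and their series is the indicator of the set where g is positive.\<close>
  define d where "d k x = G (Suc k) x - G k x" for k x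
  have g0: "0 \<le> g x" for x using g by (rule S_nonneg_ge_0)
  have GS: "G k \<in> S" for k
    unfolding G_def using g by (intro S_diff S_const S_inverse S_scale) (auto simp: S_nonneg_def)
  have G01: "0 \<le> G k x" "G k x \<le> 1" for k x
    using g0[of x] by (auto simp: G_def divide_le_eq_1)
  have inc: "G k x \<le> G (Suc k) x" for k x
    unfolding G_def using g0[of x]
    by (intro diff_left_mono divide_left_mono mult_pos_pos add_pos_nonneg add_left_mono mult_right_mono) auto
  have dN: "d k \<in> S_nonneg" for k
    unfolding S_nonneg_def d_def using GS inc by (auto intro!: S_diff)
  have cN: "(\<lambda>x. 1 - G k x) \<in> S_nonneg" for k
    unfolding S_nonneg_def using GS G01 by (auto intro!: S_diff S_const)
  have dsum: "(\<Sum>k<K. d k x) = G K x" for K x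
    by (induction K) (auto simp: d_def G_def)
  have lim: "(\<Sum>k. ennreal (d k x)) = indicator {x. 0 < g x} x" for x
  proof (cases "0 < g x")
    case True
    have "filterlim (\<lambda>k. 1 + g x * real k) at_top sequentially"
      using True
      by (intro filterlim_tendsto_add_at_top[OF tendsto_const]
          filterlim_tendsto_pos_mult_at_top[OF tendsto_const _ filterlim_real_sequentially])
    then have "(\<lambda>k. 1 / (1 + g x * real k)) \<longlonglongrightarrow> 0"
      by (rule tendsto_divide_0[OF tendsto_const filterlim_at_top_imp_at_infinity])
    then have "(\<lambda>k. G k x) \<longlonglongrightarrow> 1 - 0"
      unfolding G_def by (intro tendsto_diff tendsto_const) (simp add: mult.commute)
    then have "(\<lambda>k. d k x) sums 1"
      unfolding sums_def dsum by simp
    then show ?thesis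
      using True dN by (subst suminf_ennreal_eq[of _ 1]) (auto simp: S_nonneg_def)
  next
    case False
    then have "g x = 0" using g0[of x] by linarith
    then show ?thesis by (simp add: d_def G_def)
  qed
  have a: "?a \<le> (\<Sum>k. upper (\<lambda>x. h x * ennreal (d k x)))"
    using upper_countably_subadditive[of "\<lambda>k x. h x * ennreal (d k x)"] by (simp add: lim)
  \<comment> \<open>The increments before K together with 1 - \<open>G K\<close> form a partition of
    unity. Multiplying a cover of h by these weights gives covers of all the pieces, whose costs add
    up to the cost of the original cover.\<close>
  have "(\<Sum>k<K. upper (\<lambda>x. h x * ennreal (d k x))) + ?b \<le> upper h" for K
    unfolding upper_def[of h]
  proof (rule INF_greatest, clarify)
    fix f assume f: "range f \<subseteq> S_nonneg" "\<forall>x. h x \<le> (\<Sum>n. ennreal (f n x))"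
    then have fN: "f n \<in> S_nonneg" for n by auto
    have part: "upper (\<lambda>x. h x * ennreal (w x)) \<le> (\<Sum>n. ennreal (P (\<lambda>x. f n x * w x)))"
      if w: "w \<in> S_nonneg" for w
    proof (rule upper_le)
      show "(\<lambda>x. f n x * w x) \<in> S_nonneg" for n using fN w by (rule S_nonneg_mult)
      show "h x * ennreal (w x) \<le> (\<Sum>n. ennreal (f n x * w x))" for x
        using f(2) fN w by (auto simp: ennreal_mult S_nonneg_ge_0 intro!: mult_right_mono)
    qed
    \<comment> \<open>Where g is zero, so is \<open>G K\<close>; hence 1 - \<open>G K\<close>
      dominates the indicator.\<close>
    have "?b \<le> upper (\<lambda>x. h x * ennreal (1 - G K x))"
    proof (rule upper_mono)
      show "h x * indicator {x. \<not> 0 < g x} x \<le> h x * ennreal (1 - G K x)" for x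
        using g0[of x] by (cases "g x = 0") (auto simp: G_def)
    qed
    also have "\<dots> \<le> (\<Sum>n. ennreal (P (\<lambda>x. f n x * (1 - G K x))))"
      by (rule part[OF cN])
    finally have "(\<Sum>k<K. upper (\<lambda>x. h x * ennreal (d k x))) + ?b
      \<le> (\<Sum>k<K. \<Sum>n. ennreal (P (\<lambda>x. f n x * d k x))) + (\<Sum>n. ennreal (P (\<lambda>x. f n x * (1 - G K x))))"
      by (intro add_mono sum_mono part dN)
    also have "(\<Sum>k<K. \<Sum>n. ennreal (P (\<lambda>x. f n x * d k x)))
        = (\<Sum>n. \<Sum>k<K. ennreal (P (\<lambda>x. f n x * d k x)))"
      by (rule suminf_sum[symmetric]) simp
    also have "(\<Sum>n. \<Sum>k<K. ennreal (P (\<lambda>x. f n x * d k x))) + (\<Sum>n. ennreal (P (\<lambda>x. f n x * (1 - G K x))))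
       = (\<Sum>n. (\<Sum>k<K. ennreal (P (\<lambda>x. f n x * d k x))) + ennreal (P (\<lambda>x. f n x * (1 - G K x))))"
      by (rule suminf_add) auto
    also have "(\<lambda>n. (\<Sum>k<K. ennreal (P (\<lambda>x. f n x * d k x))) + ennreal (P (\<lambda>x. f n x * (1 - G K x))))
        = (\<lambda>n. ennreal (P (f n)))"
    proof
      fix n
      have nn: "0 \<le> P (\<lambda>x. f n x * d k x)" for k using fN dN by (intro P_S_nonneg S_nonneg_mult)
      have nc: "0 \<le> P (\<lambda>x. f n x * (1 - G K x))" using fN cN by (intro P_S_nonneg S_nonneg_mult)
      have "(\<Sum>k<K. P (\<lambda>x. f n x * d k x)) = P (\<lambda>x. f n x * G K x)"
        using fN dN by (subst P_sum[symmetric]) (auto simp: sum_distrib_left[symmetric] dsum S_nonneg_S S_mult)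
      also have "\<dots> + P (\<lambda>x. f n x * (1 - G K x)) = P (f n)"
        using S_nonneg_S[OF fN] S_nonneg_S[OF cN] GS
        by (subst P_add[symmetric]) (auto intro!: S_diff S_mult arg_cong[of _ _ P] simp: algebra_simps fun_eq_iff)
      finally have "(\<Sum>k<K. P (\<lambda>x. f n x * d k x)) + P (\<lambda>x. f n x * (1 - G K x)) = P (f n)" .
      then show "(\<Sum>k<K. ennreal (P (\<lambda>x. f n x * d k x))) + ennreal (P (\<lambda>x. f n x * (1 - G K x))) = ennreal (P (f n))"
        using nn nc by (simp add: sum_ennreal sum_nonneg flip: ennreal_plus)
    qed
    finally show "(\<Sum>k<K. upper (\<lambda>x. h x * ennreal (d k x))) + ?b \<le> (\<Sum>n. ennreal (P (f n)))" .
  qed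
  then have "(SUP K. (\<Sum>k<K. upper (\<lambda>x. h x * ennreal (d k x))) + ?b) \<le> upper h"
    by (intro SUP_least)
  then have "(\<Sum>k. upper (\<lambda>x. h x * ennreal (d k x))) + ?b \<le> upper h"
    by (simp add: ennreal_SUP_add_left suminf_eq_SUP)
  with add_right_mono[OF a] show ?thesis by (rule order_trans)
qed

section \<open>The Caratheodory measure of the upper integral\<close>

lemma outer_measure_space_upper:
  "outer_measure_space UNIV (\<lambda>A. upper (\<lambda>x. h x * indicator A x))"
  unfolding outer_measure_space_def positive_def increasing_def countably_subadditive_def
proof (intro conjI ballI allI impI)
  show "upper (\<lambda>x. h x * indicator {} x) = 0" by (simp add: upper_0)
  show "upper (\<lambda>x. h x * indicator A x) \<le> upper (\<lambda>x. h x * indicator B x)" if "A \<subseteq> B" for A B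
    using that by (intro upper_mono) (auto simp: indicator_def)
  fix A :: "nat \<Rightarrow> 'a set"
  have "upper (\<lambda>x. h x * indicator (\<Union>i. A i) x) \<le> upper (\<lambda>x. \<Sum>i. h x * indicator (A i) x)"
  proof (rule upper_mono)
    fix x
    show "h x * indicator (\<Union>i. A i) x \<le> (\<Sum>i. h x * indicator (A i) x)"
    proof (cases "x \<in> (\<Union>i. A i)")
      case True
      then obtain i where i: "x \<in> A i" by blast
      then have "h x * indicator (\<Union>i. A i) x = (\<Sum>i\<in>{i}. h x * indicator (A i) x)"
        by (auto simp: indicator_def)
      also have "\<dots> \<le> (\<Sum>i. h x * indicator (A i) x)"
        by (rule sum_le_suminf[OF summableI]) auto
      finally show ?thesis .
    qed simp
  qed
  also have "\<dots> \<le> (\<Sum>i. upper (\<lambda>x. h x * indicator (A i) x))"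
    by (rule upper_countably_subadditive)
  finally show "upper (\<lambda>x. h x * indicator (\<Union>i. A i) x) \<le> (\<Sum>i. upper (\<lambda>x. h x * indicator (A i) x))" .
qed

text \<open>Every point of U has a cozero neighbourhood inside U, and Lindelof's theorem keeps
  countably many of them. This reduces open sets to the single cozero sets treated by
  \<open>upper_split\<close>; the vanishing off U serves to locate the support.\<close>

lemma open_cozero_cover:
  assumes "open U"
  obtains \<G> where "countable \<G>" "\<G> \<subseteq> S_nonneg" "(\<Union>g\<in>\<G>. {x. 0 < g x}) = U" "\<forall>g\<in>\<G>. \<forall>x. x \<notin> U \<longrightarrow> g x = 0"
proof -
  have "\<forall>x\<in>U. \<exists>h. h \<in> S_nonneg \<and> 0 < h x \<and> (\<forall>y. y \<notin> U \<longrightarrow> h y = 0)"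
    using S_separates[OF assms] by (force simp: S_nonneg_def)
  then obtain H where H: "\<And>x. x \<in> U \<Longrightarrow> H x \<in> S_nonneg" "\<And>x. x \<in> U \<Longrightarrow> 0 < H x x"
    "\<And>x y. x \<in> U \<Longrightarrow> y \<notin> U \<Longrightarrow> H x y = 0"
    by metis
  have op: "open {y. 0 < H x y}" if "x \<in> U" for x
    using S_continuous[OF S_nonneg_S[OF H(1)[OF that]]]
    by (intro open_Collect_less continuous_on_const) auto
  obtain \<F> where F: "\<F> \<subseteq> (\<lambda>x. {y. 0 < H x y}) ` U" "countable \<F>" "\<Union>\<F> = (\<Union>x\<in>U. {y. 0 < H x y})"
    by (rule Lindelof[of "(\<lambda>x. {y. 0 < H x y}) ` U"]) (use op in auto)
  have "\<exists>C. countable C \<and> C \<subseteq> U \<and> \<F> = (\<lambda>x. {y. 0 < H x y}) ` C"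
    using F(1,2) by (intro iffD1[OF countable_subset_image] conjI)
  then obtain C where C: "countable C" "C \<subseteq> U" "\<F> = (\<lambda>x. {y. 0 < H x y}) ` C"
    by blast
  have "(\<Union>g\<in>H ` C. {x. 0 < g x}) = (\<Union>x\<in>U. {y. 0 < H x y})"
    using C F(3) by auto
  also have "\<dots> = U"
  proof
    show "(\<Union>x\<in>U. {y. 0 < H x y}) \<subseteq> U" using H(3) by fastforce
    show "U \<subseteq> (\<Union>x\<in>U. {y. 0 < H x y})" using H(2) by auto
  qed
  finally have "(\<Union>g\<in>H ` C. {x. 0 < g x}) = U" .
  moreover have "H ` C \<subseteq> S_nonneg" "\<forall>g\<in>H ` C. \<forall>x. x \<notin> U \<longrightarrow> g x = 0"
    using C(2) H(1,3) by auto
  ultimately show ?thesis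
    using that[of "H ` C"] C(1) by simp
qed

text \<open>The weight h is used twice: h = 1 gives the representing measure, and h = f gives the
  measure whose mass is compared with that of the density f.\<close>

definition upper_measure :: "('a \<Rightarrow> ennreal) \<Rightarrow> 'a measure" where
  "upper_measure h = measure_of UNIV (sets borel) (\<lambda>A. upper (\<lambda>x. h x * indicator A x))"

lemma space_upper_measure [simp]: "space (upper_measure h) = UNIV"
  by (simp add: upper_measure_def space_measure_of_conv)

lemma sets_upper_measure [simp, measurable_cong]: "sets (upper_measure h) = sets borel"
  using sets.sigma_sets_eq[of "borel :: 'a measure"] by (simp add: upper_measure_def)

text \<open>\<open>measure_of\<close> falls back to zero unless the set function is a measure on the
  Borel sets. \<open>upper_split\<close> is the Caratheodory criterion for cozero sets; open sets
  are countable unions of these, so the lambda system contains all Borel sets.\<close>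

lemma emeasure_upper_measure:
  assumes "A \<in> sets borel"
  shows "emeasure (upper_measure h) A = upper (\<lambda>x. h x * indicator A x)"
proof -
  let ?m = "\<lambda>A. upper (\<lambda>x. h x * indicator A x)"
  let ?L = "lambda_system UNIV UNIV ?m"
  interpret PU: sigma_algebra UNIV "UNIV :: 'a set set"
    using sigma_algebra_Pow[of "UNIV :: 'a set"] by simp
  have ms: "measure_space UNIV ?L ?m"
    by (rule PU.caratheodory_lemma[OF outer_measure_space_upper])
  then interpret L: sigma_algebra UNIV ?L by (simp add: measure_space_def)
  have coz: "{x. 0 < g x} \<in> ?L" if "g \<in> S_nonneg" for g
    unfolding lambda_system_def
  proof (clarsimp, rule antisym)
    fix X
    \<comment> \<open>The test set X of the criterion is absorbed into the weight.\<close>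
    have eq: "?m ({x. 0 < g x} \<inter> X) = upper (\<lambda>x. h x * indicator X x * indicator {x. 0 < g x} x)"
         "?m ((UNIV - {x. 0 < g x}) \<inter> X) = upper (\<lambda>x. h x * indicator X x * indicator {x. \<not> 0 < g x} x)"
      by (auto intro!: arg_cong[of _ _ upper] simp: indicator_def)
    then show "?m ({x. 0 < g x} \<inter> X) + ?m ((UNIV - {x. 0 < g x}) \<inter> X) \<le> ?m X"
      using upper_split[OF that, of "\<lambda>x. h x * indicator X x"] by simp
    have sub: "subadditive UNIV ?m"
      using outer_measure_space_upper[of h] PU.countably_subadditive_subadditive
      unfolding outer_measure_space_def by blast
    have "({x. 0 < g x} \<inter> X) \<union> ((UNIV - {x. 0 < g x}) \<inter> X) = X" by blast
    then show "?m X \<le> ?m ({x. 0 < g x} \<inter> X) + ?m ((UNIV - {x. 0 < g x}) \<inter> X)"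
      using subadditiveD[OF sub, of "{x. 0 < g x} \<inter> X" "(UNIV - {x. 0 < g x}) \<inter> X"] by auto
  qed
  have "U \<in> ?L" if "open U" for U
  proof -
    obtain \<G> where G: "countable \<G>" "\<G> \<subseteq> S_nonneg" "(\<Union>g\<in>\<G>. {x. 0 < g x}) = U"
      using open_cozero_cover[OF \<open>open U\<close>] by (metis (no_types, lifting))
    have "(\<Union>g\<in>\<G>. {x. 0 < g x}) \<in> ?L"
      using G(1,2) coz by (intro L.countable_UN'') auto
    then show ?thesis using G(3) by simp
  qed
  then have sub: "sets (borel :: 'a measure) \<subseteq> ?L"
    unfolding borel_def by (simp, intro L.sigma_sets_subset) auto
  have "measure_space UNIV (sets borel) ?m"
    unfolding measure_space_def
  proof (intro conjI)
    show "sigma_algebra UNIV (sets (borel :: 'a measure))"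
      using sets.sigma_algebra_axioms[of "borel :: 'a measure"] by simp
    show "positive (sets borel) ?m" by (simp add: positive_def upper_0)
    have ca: "countably_additive ?L ?m" using ms by (simp add: measure_space_def)
    show "countably_additive (sets borel) ?m"
      unfolding countably_additive_def
    proof (intro allI impI)
      fix A :: "nat \<Rightarrow> 'a set"
      assume A: "range A \<subseteq> sets borel" "disjoint_family A" "(\<Union>i. A i) \<in> sets borel"
      then have "range A \<subseteq> ?L" "(\<Union>i. A i) \<in> ?L" using sub by auto
      with ca A(2) show "(\<Sum>i. ?m (A i)) = ?m (\<Union>i. A i)"
        unfolding countably_additive_def by (elim allE[of _ A]) simp
    qed
  qed
  then have pos: "positive (sets (upper_measure h)) ?m"
    and ca: "countably_additive (sets (upper_measure h)) ?m"
    by (simp_all only: measure_space_def sets_upper_measure)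
  have "A \<in> sets (upper_measure h)" using assms by simp
  from emeasure_measure_of[OF upper_measure_def[of h] _ pos ca this] show ?thesis
    by simp
qed

lemma upper_measure_indicator: "A \<in> sets borel \<Longrightarrow> emeasure (upper_measure (\<lambda>x. 1)) A = upper (indicator A)"
  by (simp add: emeasure_upper_measure)

lemma finite_measure_upper_measure: "finite_measure (upper_measure (\<lambda>x. 1))"
proof (rule finite_measureI)
  have "upper (indicator UNIV) \<le> ennreal (P (\<lambda>x. 1))"
    by (rule upper_le1) (auto simp: S_nonneg_def S_const)
  then have "upper (indicator UNIV) \<noteq> \<infinity>" by (auto simp: top_unique)
  then show "emeasure (upper_measure (\<lambda>x. 1)) (space (upper_measure (\<lambda>x. 1))) \<noteq> \<infinity>"
    by (simp add: upper_measure_indicator)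
qed

text \<open>This is Dini's theorem: compactness of the support makes finitely many terms of the cover
  suffice up to a small constant.\<close>

lemma upper_eq_P:
  assumes f: "f \<in> S_nonneg" and K: "compact K" "\<And>x. x \<notin> K \<Longrightarrow> f x = 0"
  shows "upper (\<lambda>x. ennreal (f x)) = ennreal (P f)"
proof (rule antisym)
  show "upper (\<lambda>x. ennreal (f x)) \<le> ennreal (P f)"
    by (rule upper_le1[OF f]) simp
  show "ennreal (P f) \<le> upper (\<lambda>x. ennreal (f x))"
    unfolding upper_def
  proof (rule INF_greatest, clarify)
    fix F assume F: "range F \<subseteq> S_nonneg" "\<forall>x. ennreal (f x) \<le> (\<Sum>n. ennreal (F n x))"
    then have FN: "F n \<in> S_nonneg" for n by auto
    show "ennreal (P f) \<le> (\<Sum>n. ennreal (P (F n)))"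
    proof (rule ennreal_le_epsilon)
      fix e :: real assume e: "0 < e"
      \<comment> \<open>Chosen so that the constant function d costs at most e; the added 1 keeps
        the denominator positive when P vanishes on constants.\<close>
      define d where "d = e / (P (\<lambda>x. 1) + 1)"
      have "0 < P (\<lambda>x. 1) + 1" using P_nonneg[OF S_const[of 1]] by (simp add: add_nonneg_pos)
      with e have d: "0 < d" "d * P (\<lambda>x. 1) \<le> e"
        by (simp_all add: d_def pos_divide_le_eq algebra_simps)
      have sumS: "(\<lambda>x. \<Sum>n<m. F n x) \<in> S" for m
        using FN by (intro S_sum) (auto simp: S_nonneg_S)
      define V where "V m = {x. f x < (\<Sum>n<m. F n x) + d}" for m
      have opV: "open (V m)" for m
        unfolding V_def using S_continuous[OF sumS[of m]] S_continuous[OF S_nonneg_S[OF f]]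
        by (intro open_Collect_less continuous_on_add continuous_on_const) auto
      \<comment> \<open>If x were in no \<open>V m\<close>, all partial sums would stay below f x -
        d, and so would the series, which has to reach f x.\<close>
      have "x \<in> (\<Union>m. V m)" for x
      proof (rule ccontr)
        assume "x \<notin> (\<Union>m. V m)"
        then have "(\<Sum>n<m. F n x) + d \<le> f x" for m by (auto simp: V_def not_less)
        then have *: "(\<Sum>n<m. F n x) \<le> f x - d" for m by (simp add: le_diff_eq)
        from *[of 0] have fd: "0 \<le> f x - d" by simp
        have "(\<Sum>n. ennreal (F n x)) \<le> ennreal (f x - d)"
        proof (rule suminf_le_const[OF summableI])
          show "(\<Sum>n<m. ennreal (F n x)) \<le> ennreal (f x - d)" for m
            using * FN by (simp add: sum_ennreal S_nonneg_ge_0 ennreal_leI)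
        qed
        also have "\<dots> < ennreal (f x)" using fd d(1) by (intro ennreal_lessI) auto
        finally show False using F(2) by (simp add: not_less[symmetric])
      qed
      then have "K \<subseteq> (\<Union>m\<in>UNIV. V m)" by auto
      then obtain C where C: "finite C" "K \<subseteq> (\<Union>m\<in>C. V m)"
        by (rule compactE_image[OF K(1), rotated]) (auto simp: opV)
      \<comment> \<open>The inserted 0 keeps \<open>Max\<close> meaningful when \<open>C\<close> is
        empty.\<close>
      define m where "m = Max (insert 0 C)"
      have le: "f x \<le> (\<Sum>n<m. F n x) + d" for x
      proof (cases "x \<in> K")
        case True
        then obtain c where c: "c \<in> C" "x \<in> V c" using C by auto
        then have "c \<le> m" using C(1) by (simp add: m_def)
        then have "(\<Sum>n<c. F n x) \<le> (\<Sum>n<m. F n x)"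
          using FN by (intro sum_mono2) (auto simp: S_nonneg_ge_0)
        then show ?thesis using c(2) by (simp add: V_def)
      next
        case False
        then show ?thesis using K(2) d(1) FN by (simp add: S_nonneg_ge_0 sum_nonneg)
      qed
      have dS: "(\<lambda>x. d * 1) \<in> S" by (rule S_const)
      have "P f \<le> P (\<lambda>x. (\<Sum>n<m. F n x) + d * 1)"
        using f le by (intro P_mono S_add sumS S_const) (auto simp: S_nonneg_S)
      also have "\<dots> = (\<Sum>n<m. P (F n)) + d * P (\<lambda>x. 1)"
        unfolding P_add[OF sumS dS] using FN S_const
        by (subst P_sum) (auto simp: S_nonneg_S P_scale[of "\<lambda>x. 1" d, simplified])
      also have "\<dots> \<le> (\<Sum>n<m. P (F n)) + e" using d(2) by simp
      finally have "ennreal (P f) \<le> ennreal ((\<Sum>n<m. P (F n)) + e)" by (rule ennreal_leI)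
      also have "\<dots> = (\<Sum>n<m. ennreal (P (F n))) + ennreal e"
        using FN e by (simp add: P_S_nonneg sum_nonneg sum_ennreal)
      also have "\<dots> \<le> (\<Sum>n. ennreal (P (F n))) + ennreal e"
        by (intro add_right_mono sum_le_suminf summableI) auto
      finally show "ennreal (P f) \<le> (\<Sum>n. ennreal (P (F n))) + ennreal e" .
    qed
  qed
qed

end

section \<open>Comparison of measures on level sets\<close>

text \<open>On the slice where f lies in [j e, (j + 1) e), A is at most (j + 1) e M and B is at
  least j e M. The defects e M(slice) sum to e M(space), which is arbitrarily small as M is finite.
  Applied in both directions, this equates the masses of two measures that behave like f M.\<close>

lemma emeasure_le_by_levels:
  fixes f :: "'a \<Rightarrow> real"
  assumes M: "finite_measure M" and f: "f \<in> borel_measurable M" "\<And>x. 0 \<le> f x"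
    and sets: "sets A = sets M" "sets B = sets M"
    and A: "\<And>X c. X \<in> sets M \<Longrightarrow> 0 < c \<Longrightarrow> (\<And>x. x \<in> X \<Longrightarrow> f x \<le> c) \<Longrightarrow> emeasure A X \<le> ennreal c * emeasure M X"
    and B: "\<And>X c. X \<in> sets M \<Longrightarrow> 0 < c \<Longrightarrow> (\<And>x. x \<in> X \<Longrightarrow> c \<le> f x) \<Longrightarrow> ennreal c * emeasure M X \<le> emeasure B X"
  shows "emeasure A (space M) \<le> emeasure B (space M)"
proof -
  interpret finite_measure M by fact
  have main: "emeasure A (space M) \<le> emeasure B (space M) + ennreal (e * (measure M (space M)))" if e: "0 < e" for e
  proof -
    define X where "X j = {x\<in>space M. real j * e \<le> f x \<and> f x < (real j + 1) * e}" for j :: nat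
    have X: "X j \<in> sets M" for j unfolding X_def using f(1) by measurable
    have disj: "disjoint_family X"
      unfolding disjoint_family_on_def
    proof safe
      fix i j x assume ij: "i \<noteq> j" "x \<in> X i" "x \<in> X j"
      then have "real i * e < (real j + 1) * e" "real j * e < (real i + 1) * e"
        unfolding X_def by auto
      then have "real i < real j + 1" "real j < real i + 1" using e by auto
      then show "x \<in> {}" using ij(1) by auto
    qed
    have "x \<in> (\<Union>j. X j)" if "x \<in> space M" for x
    proof -
      define j where "j = nat \<lfloor>f x / e\<rfloor>"
      have "real j = of_int \<lfloor>f x / e\<rfloor>" using f(2)[of x] e by (simp add: j_def)
      then have "real j \<le> f x / e" "f x / e < real j + 1" by linarith+
      then show ?thesis using e that by (auto simp: X_def field_simps intro!: exI[of _ j])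
    qed
    then have U: "(\<Union>j. X j) = space M" by (auto simp: X_def)
    have "emeasure A (space M) = (\<Sum>j. emeasure A (X j))"
      using suminf_emeasure[of X A] X disj U sets by (simp add: image_subset_iff)
    also have "\<dots> \<le> (\<Sum>j. emeasure B (X j) + ennreal e * emeasure M (X j))"
    proof (intro suminf_le summableI)
      fix j
      have "emeasure A (X j) \<le> ennreal ((real j + 1) * e) * emeasure M (X j)"
        using e by (intro A X) (auto simp: X_def)
      also have "\<dots> = ennreal (real j * e) * emeasure M (X j) + ennreal e * emeasure M (X j)"
        using e by (simp add: distrib_right ennreal_plus)
      also have "ennreal (real j * e) * emeasure M (X j) \<le> emeasure B (X j)"
      \<comment> \<open>The hypothesis on B asks for a positive constant; on the lowest slice the
        left side is zero.\<close>
      proof (cases "j = 0")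
        case False
        then show ?thesis using e by (intro B X) (auto simp: X_def)
      qed simp
      finally show "emeasure A (X j) \<le> emeasure B (X j) + ennreal e * emeasure M (X j)"
        by (simp add: add_right_mono)
    qed
    also have "\<dots> = (\<Sum>j. emeasure B (X j)) + ennreal e * (\<Sum>j. emeasure M (X j))"
      by (subst suminf_add[symmetric]) auto
    also have "(\<Sum>j. emeasure B (X j)) = emeasure B (space M)"
      using suminf_emeasure[of X B] X disj U sets by (simp add: image_subset_iff)
    also have "(\<Sum>j. emeasure M (X j)) = emeasure M (space M)"
      using suminf_emeasure[of X M] X disj U by (simp add: image_subset_iff)
    finally show ?thesis using e by (simp add: emeasure_eq_measure ennreal_mult')
  qed
  show ?thesis
  proof (rule ennreal_le_epsilon)
    fix d :: real assume d: "0 < d"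
    define e where "e = d / (measure M (space M) + 1)"
    have "0 < measure M (space M) + 1" by (simp add: add_nonneg_pos)
    with d have e: "0 < e" "e * measure M (space M) \<le> d"
      by (simp_all add: e_def pos_divide_le_eq algebra_simps)
    have "emeasure A (space M) \<le> emeasure B (space M) + ennreal (e * measure M (space M))"
      by (rule main[OF e(1)])
    also have "\<dots> \<le> emeasure B (space M) + ennreal d"
      by (intro add_left_mono ennreal_leI e)
    finally show "emeasure A (space M) \<le> emeasure B (space M) + ennreal d" .
  qed
qed

context positive_functional
begin

text \<open>The measure with weight f and the density of f over the representing measure obey the
  same bounds on sets where f is at most, or at least, c; so their total masses agree. The first
  mass is P f by \<open>upper_eq_P\<close>, the second is the integral.\<close>

lemma nn_integral_upper_measure:
  assumes f: "f \<in> S_nonneg" and K: "compact K" "\<And>x. x \<notin> K \<Longrightarrow> f x = 0"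
  shows "(\<integral>\<^sup>+x. ennreal (f x) \<partial>upper_measure (\<lambda>x. 1)) = ennreal (P f)"
proof -
  let ?M = "upper_measure (\<lambda>x. 1)"
  let ?A = "upper_measure (\<lambda>x. ennreal (f x))" and ?B = "density ?M (\<lambda>x. ennreal (f x))"
  have mf: "f \<in> borel_measurable ?M"
    using S_continuous[OF S_nonneg_S[OF f]] by (simp add: borel_measurable_continuous_onI measurable_cong_sets[OF sets_upper_measure refl])
  have scale: "ennreal c * emeasure ?M X = upper (\<lambda>x. ennreal c * indicator X x)"
    if "X \<in> sets ?M" "0 < c" for X c
    using that by (simp add: upper_measure_indicator upper_scale)
  have A1: "emeasure ?A X \<le> ennreal c * emeasure ?M X"
    if "X \<in> sets ?M" "0 < c" "\<And>x. x \<in> X \<Longrightarrow> f x \<le> c" for X c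
    using that unfolding scale[OF that(1,2)]
    by (auto simp: emeasure_upper_measure indicator_def intro!: upper_mono ennreal_leI)
  have A2: "ennreal c * emeasure ?M X \<le> emeasure ?A X"
    if "X \<in> sets ?M" "0 < c" "\<And>x. x \<in> X \<Longrightarrow> c \<le> f x" for X c
    using that unfolding scale[OF that(1,2)]
    by (auto simp: emeasure_upper_measure indicator_def intro!: upper_mono ennreal_leI)
  have eB: "emeasure ?B X = (\<integral>\<^sup>+x. ennreal (f x) * indicator X x \<partial>?M)" if "X \<in> sets ?M" for X
    using that mf by (subst emeasure_density) auto
  have eC: "ennreal c * emeasure ?M X = (\<integral>\<^sup>+x. ennreal c * indicator X x \<partial>?M)" if "X \<in> sets ?M" for X c
    using that by (subst nn_integral_cmult_indicator) auto
  have B1: "emeasure ?B X \<le> ennreal c * emeasure ?M X"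
    if "X \<in> sets ?M" "0 < c" "\<And>x. x \<in> X \<Longrightarrow> f x \<le> c" for X c
    unfolding eB[OF that(1)] eC[OF that(1)]
    using that by (intro nn_integral_mono) (auto simp: indicator_def intro!: ennreal_leI)
  have B2: "ennreal c * emeasure ?M X \<le> emeasure ?B X"
    if "X \<in> sets ?M" "0 < c" "\<And>x. x \<in> X \<Longrightarrow> c \<le> f x" for X c
    unfolding eB[OF that(1)] eC[OF that(1)]
    using that by (intro nn_integral_mono) (auto simp: indicator_def intro!: ennreal_leI)
  have "emeasure ?A (space ?M) = emeasure ?B (space ?M)"
    by (intro antisym emeasure_le_by_levels[OF finite_measure_upper_measure mf S_nonneg_ge_0[OF f]] A1 A2 B1 B2)
       simp_all
  then show ?thesis
    using upper_eq_P[OF f K] by (simp add: emeasure_upper_measure eB)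
qed

text \<open>Infinitely many copies of g cover the indicator of the set where g is positive, at total
  cost zero once P g = 0. Countably many such sets fill U.\<close>

lemma emeasure_upper_measure_eq_0:
  assumes U: "open U" and P: "\<And>f. f \<in> S \<Longrightarrow> (\<And>x. x \<notin> U \<Longrightarrow> f x = 0) \<Longrightarrow> P f = 0"
  shows "emeasure (upper_measure (\<lambda>x. 1)) U = 0"
proof -
  obtain \<G> where G: "countable \<G>" "\<G> \<subseteq> S_nonneg" "(\<Union>g\<in>\<G>. {x. 0 < g x}) = U"
      "\<forall>g\<in>\<G>. \<forall>x. x \<notin> U \<longrightarrow> g x = 0"
    by (rule open_cozero_cover[OF U])
  have op: "open {x. 0 < g x}" if "g \<in> \<G>" for g
    using S_continuous[OF S_nonneg_S, of g] G(2) that by (intro open_Collect_less continuous_on_const) auto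
  have "{x. 0 < g x} \<in> null_sets (upper_measure (\<lambda>x. 1))" if g: "g \<in> \<G>" for g
  proof -
    have gN: "g \<in> S_nonneg" using g G(2) by auto
    have "upper (indicator {x. 0 < g x}) \<le> (\<Sum>n::nat. ennreal (P g))"
    proof (rule upper_le)
      fix x
      have "(\<Sum>n::nat. ennreal (g x)) = \<infinity>" if "0 < g x"
      proof (rule ccontr)
        assume "(\<Sum>n::nat. ennreal (g x)) \<noteq> \<infinity>"
        then have "summable (\<lambda>n::nat. g x)"
          using that by (intro summable_suminf_not_top) auto
        then show False using that by (simp add: summable_const_iff)
      qed
      then show "indicator {x. 0 < g x} x \<le> (\<Sum>n::nat. ennreal (g x))"
        by (auto simp: indicator_def)
    qed (rule gN)
    also have "P g = 0" using gN G(4) g by (intro P) (auto simp: S_nonneg_S)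
    finally show ?thesis using op[OF g] by (intro null_setsI) (auto simp: upper_measure_indicator)
  qed
  then have "(\<Union>g\<in>\<G>. {x. 0 < g x}) \<in> null_sets (upper_measure (\<lambda>x. 1))"
    by (rule null_sets_UN'[OF G(1)])
  then show ?thesis using G(3) by auto
qed

text \<open>The positive part of f may fall outside \<open>S\<close>. Instead f = (f + w) - w splits
  f into two nonnegative members of \<open>S\<close> with compact support.\<close>

lemma integral_upper_measure:
  assumes f: "f \<in> S" and w: "w \<in> S" "\<And>x. \<bar>f x\<bar> \<le> w x"
    and K: "compact K" "\<And>x. x \<notin> K \<Longrightarrow> w x = 0"
  shows "(LINT x|upper_measure (\<lambda>x. 1). f x) = P f"
proof -
  let ?M = "upper_measure (\<lambda>x. 1)"
  have *: "has_bochner_integral ?M g (P g)" if g: "g \<in> S_nonneg" "\<And>x. x \<notin> K \<Longrightarrow> g x = 0" for g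
  proof (rule has_bochner_integral_nn_integral)
    show "g \<in> borel_measurable ?M"
      using S_continuous[OF S_nonneg_S[OF g(1)]] by (simp add: borel_measurable_continuous_onI measurable_cong_sets[OF sets_upper_measure refl])
    show "(\<integral>\<^sup>+x. ennreal (g x) \<partial>?M) = ennreal (P g)"
      by (rule nn_integral_upper_measure[OF g(1) K(1) g(2)])
  qed (use g in \<open>auto simp: P_S_nonneg S_nonneg_ge_0\<close>)
  have w0: "0 \<le> w x" for x using w(2)[of x] by linarith
  have "has_bochner_integral ?M (\<lambda>x. (f x + w x) - w x) (P (\<lambda>x. f x + w x) - P w)"
  proof (intro has_bochner_integral_diff *)
    show "f x + w x = 0" if "x \<notin> K" for x using K(2)[OF that] w(2)[of x] by simp
    show "(\<lambda>x. f x + w x) \<in> S_nonneg"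
      unfolding S_nonneg_def
    proof (intro CollectI conjI allI)
      show "0 \<le> f x + w x" for x using w(2)[of x] by linarith
    qed (rule S_add[OF f w(1)])
  qed (use w w0 K in \<open>auto simp: S_nonneg_def\<close>)
  then show ?thesis by (auto simp: P_add f w dest: has_bochner_integral_integral_eq)
qed

end

section \<open>Representing measures for functionals on bounded C^1 functions\<close>

text \<open>Only compactly supported f are tested: a positive functional on all bounded C^1
  functions may have a part at infinity that no measure detects.\<close>

definition represented_by :: "(('a::euclidean_space \<Rightarrow> real) \<Rightarrow> real) \<Rightarrow> 'a measure \<Rightarrow> bool" where
  "represented_by P M \<longleftrightarrow> finite_measure M \<and> sets M = sets borel \<and>
    (\<forall>f K. C1b f \<longrightarrow> compact K \<longrightarrow> (\<forall>x. x \<notin> K \<longrightarrow> f x = 0) \<longrightarrow> (LINT x|M. f x) = P f)"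

lemma C1b_measure_representation:
  fixes P :: "('a::euclidean_space \<Rightarrow> real) \<Rightarrow> real"
  assumes add: "\<And>f g. C1b f \<Longrightarrow> C1b g \<Longrightarrow> P (\<lambda>x. f x + g x) = P f + P g"
    and scale: "\<And>f c. C1b f \<Longrightarrow> P (\<lambda>x. c * f x) = c * P f"
    and nonneg: "\<And>f. C1b f \<Longrightarrow> (\<And>x. 0 \<le> f x) \<Longrightarrow> 0 \<le> P f"
    and U: "open U" and zero: "\<And>f. C1b f \<Longrightarrow> (\<And>x. x \<notin> U \<Longrightarrow> f x = 0) \<Longrightarrow> P f = 0"
  shows "\<exists>M. represented_by P M \<and> emeasure M U = 0"
proof -
  interpret positive_functional "{f. C1b f}" P
  proof
    fix U and x :: 'a assume "open U" "x \<in> U"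
    then obtain r where r: "0 < r" "ball x r \<subseteq> U"
      using open_contains_ball_eq by blast
    have "0 < bump x r x" using r(1) by (simp add: bump_def max_def)
    moreover have "\<forall>y. y \<notin> U \<longrightarrow> bump x r y = 0"
      using bump_eq_0[OF _ r(1)] r(2) by (metis subsetD)
    ultimately have "(\<forall>y. 0 \<le> bump x r y) \<and> 0 < bump x r x \<and> (\<forall>y. y \<notin> U \<longrightarrow> bump x r y = 0)"
      by (simp add: bump_nonneg)
    then show "\<exists>h\<in>{f :: 'a \<Rightarrow> real. C1b f}. (\<forall>y. 0 \<le> h y) \<and> 0 < h x \<and> (\<forall>y. y \<notin> U \<longrightarrow> h y = 0)"
      using C1b_bump[OF r(1), of x] by (intro bexI[of _ "bump x r"]) simp_all
  qed (simp_all add: C1b_const C1b_add C1b_mult C1b_inverse C1b_continuous add scale nonneg)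
  let ?M = "upper_measure (\<lambda>x. 1)"
  have int: "(LINT x|?M. f x) = P f"
    if f: "C1b f" and K: "compact K" "\<forall>x. x \<notin> K \<longrightarrow> f x = 0" for f K
  proof -
    obtain B where B: "0 < B" "\<And>x. \<bar>f x\<bar> \<le> B"
      using C1b_bounded[OF f] by (auto simp: bounded_pos)
    obtain s where s: "\<And>x. x \<in> K \<Longrightarrow> norm x \<le> s"
      using compact_imp_bounded[OF K(1)] by (auto simp: bounded_iff)
    \<comment> \<open>On K the difference R^2 - |x|^2 is at least (|s| + 1)^2 - |s|^2, hence at
      least 1, so B times the bump dominates f. The absolute value covers a negative s, possible for
      empty K.\<close>
    define R where "R = \<bar>s\<bar> + 1"
    have R: "0 < R" by (simp add: R_def)
    have ge1: "1 \<le> bump 0 R x" if "x \<in> K" for x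
    proof -
      have "(norm x)\<^sup>2 \<le> \<bar>s\<bar>\<^sup>2" using s[OF that] by (intro power_mono) auto
      then have "1 \<le> R\<^sup>2 - (x - 0) \<bullet> (x - 0)"
        by (simp add: R_def power2_sum power2_norm_eq_inner)
      then show ?thesis unfolding bump_def by (intro one_le_power) simp
    qed
    show ?thesis
    proof (rule integral_upper_measure)
      show "(\<lambda>x. B * bump 0 R x) \<in> {f. C1b f}"
        using C1b_mult[OF C1b_const C1b_bump[OF R]] by auto
      show "\<bar>f x\<bar> \<le> B * bump 0 R x" for x
      proof (cases "x \<in> K")
        case True
        have "\<bar>f x\<bar> \<le> B * 1" using B(2) by simp
        also have "\<dots> \<le> B * bump 0 R x" using ge1[OF True] B(1) by (intro mult_left_mono) auto
        finally show ?thesis .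
      next
        case False
        then show ?thesis using K(2) B(1) bump_nonneg[of 0 R x] by simp
      qed
      show "compact (cball (0::'a) R)" by simp
      show "B * bump 0 R x = 0" if "x \<notin> cball 0 R" for x
        using that bump_eq_0[of x 0 R] R by simp
    qed (use f in simp)
  qed
  have "emeasure ?M U = 0"
    by (rule emeasure_upper_measure_eq_0[OF U]) (use zero in simp)
  moreover have "represented_by P ?M"
    unfolding represented_by_def using finite_measure_upper_measure int by simp
  ultimately show ?thesis by (intro exI[of _ ?M] conjI)
qed

section \<open>Vector measures from pairs of finite measures\<close>

text \<open>Each dominating measure is additive over a disjoint family, so the setwise bound
  survives the supremum over partitions.\<close>

lemma total_variation_le:
  fixes \<mu> :: "'a::topological_space set \<Rightarrow> 'b::real_normed_vector" and M :: "'i \<Rightarrow> 'a measure"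
  assumes M: "\<And>i. i \<in> I \<Longrightarrow> finite_measure (M i)" "\<And>i. i \<in> I \<Longrightarrow> sets (M i) = sets borel"
    and \<mu>: "\<And>B. B \<in> sets borel \<Longrightarrow> norm (\<mu> B) \<le> (\<Sum>i\<in>I. measure (M i) B)"
    and A: "A \<in> sets borel"
  shows "total_variation \<mu> A \<le> (\<Sum>i\<in>I. emeasure (M i) A)"
  unfolding total_variation_def
proof (rule SUP_least, clarify)
  fix P :: "'a set set"
  assume P: "finite P" "disjoint P" "P \<subseteq> sets borel" "\<Union>P \<subseteq> A"
  have "(\<Sum>B\<in>P. ennreal (norm (\<mu> B))) \<le> (\<Sum>B\<in>P. \<Sum>i\<in>I. emeasure (M i) B)"
  proof (rule sum_mono)
    fix B assume B: "B \<in> P"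
    have "ennreal (norm (\<mu> B)) \<le> ennreal (\<Sum>i\<in>I. measure (M i) B)"
      using B P(3) by (intro ennreal_leI \<mu>) auto
    also have "\<dots> = (\<Sum>i\<in>I. ennreal (measure (M i) B))"
      by (rule sum_ennreal[symmetric]) simp
    also have "\<dots> = (\<Sum>i\<in>I. emeasure (M i) B)"
      by (intro sum.cong refl finite_measure.emeasure_eq_measure[symmetric] M)
    finally show "ennreal (norm (\<mu> B)) \<le> (\<Sum>i\<in>I. emeasure (M i) B)" .
  qed
  also have "\<dots> = (\<Sum>i\<in>I. \<Sum>B\<in>P. emeasure (M i) B)" by (rule sum.swap)
  also have "\<dots> \<le> (\<Sum>i\<in>I. emeasure (M i) A)"
  proof (rule sum_mono)
    fix i assume i: "i \<in> I"
    have "(\<Sum>B\<in>P. emeasure (M i) B) = emeasure (M i) (\<Union>B\<in>P. B)"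
      using P M(2)[OF i] by (intro sum_emeasure) (auto simp: disjoint_family_on_def disjoint_def)
    also have "\<dots> \<le> emeasure (M i) A"
      using P(4) A M(2)[OF i] by (intro emeasure_mono) auto
    finally show "(\<Sum>B\<in>P. emeasure (M i) B) \<le> emeasure (M i) A" .
  qed
  finally show "(\<Sum>B\<in>P. ennreal (norm (\<mu> B))) \<le> (\<Sum>i\<in>I. emeasure (M i) A)" .
qed

lemma bounded_vector_measureI:
  fixes \<mu> :: "'a::topological_space set \<Rightarrow> 'b::real_normed_vector" and M :: "'i \<Rightarrow> 'a measure"
  assumes I: "finite I" and M: "\<And>i. i \<in> I \<Longrightarrow> finite_measure (M i)" "\<And>i. i \<in> I \<Longrightarrow> sets (M i) = sets borel"
    and \<mu>: "\<And>B. B \<in> sets borel \<Longrightarrow> norm (\<mu> B) \<le> (\<Sum>i\<in>I. measure (M i) B)"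
    and sums: "\<And>A :: nat \<Rightarrow> 'a set. range A \<subseteq> sets borel \<Longrightarrow> disjoint_family A \<Longrightarrow> (\<lambda>i. \<mu> (A i)) sums \<mu> (\<Union>i. A i)"
  shows "bounded_vector_measure \<mu>"
proof -
  have "(\<Sum>i\<in>I. emeasure (M i) UNIV) < \<infinity>"
    using I M(1) by (simp add: finite_measure.emeasure_eq_measure less_top)
  then have "total_variation \<mu> UNIV < \<infinity>"
    using total_variation_le[of I M \<mu> UNIV, OF M \<mu>] by (auto intro: le_less_trans)
  then show ?thesis unfolding bounded_vector_measure_def using sums by blast
qed

lemma abs_measure_diff_le: "\<bar>measure M A - measure N A\<bar> \<le> measure M A + measure N A"
  using measure_nonneg[of M A] measure_nonneg[of N A] by linarith

section \<open>Integration against differences of measures\<close>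

text \<open>Sums on both sides avoid differences of extended values. In the application A and C are
  the positive and negative variations of a difference of measures, and B and D the two measures
  themselves.\<close>

lemma nn_integral_add_measures:
  fixes A B C D :: "'a measure"
  assumes sets: "sets B = sets A" "sets C = sets A" "sets D = sets A"
    and eq: "\<And>X. X \<in> sets A \<Longrightarrow> emeasure A X + emeasure B X = emeasure C X + emeasure D X"
    and f: "f \<in> borel_measurable A"
  shows "(\<integral>\<^sup>+x. f x \<partial>A) + (\<integral>\<^sup>+x. f x \<partial>B) = (\<integral>\<^sup>+x. f x \<partial>C) + (\<integral>\<^sup>+x. f x \<partial>D)"
  using f
proof (induction rule: borel_measurable_induct)
  case (cong f g)
  have "space B = space A" "space C = space A" "space D = space A"
    using sets by (auto dest: sets_eq_imp_space_eq)
  then have "(\<integral>\<^sup>+x. f x \<partial>A) = (\<integral>\<^sup>+x. g x \<partial>A)" "(\<integral>\<^sup>+x. f x \<partial>B) = (\<integral>\<^sup>+x. g x \<partial>B)"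
    "(\<integral>\<^sup>+x. f x \<partial>C) = (\<integral>\<^sup>+x. g x \<partial>C)" "(\<integral>\<^sup>+x. f x \<partial>D) = (\<integral>\<^sup>+x. g x \<partial>D)"
    using cong(3) by (auto intro!: nn_integral_cong)
  with cong(4) show ?case by simp
next
  case (set X)
  then show ?case using eq sets by simp
next
  case (mult u c)
  then have "u \<in> borel_measurable B" "u \<in> borel_measurable C" "u \<in> borel_measurable D"
    using sets by (simp_all cong: measurable_cong_sets)
  with mult show ?case by (simp add: nn_integral_cmult flip: distrib_left)
next
  case (add u v)
  then have "u \<in> borel_measurable B" "u \<in> borel_measurable C" "u \<in> borel_measurable D"
    "v \<in> borel_measurable B" "v \<in> borel_measurable C" "v \<in> borel_measurable D"
    using sets by (simp_all cong: measurable_cong_sets)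
  then have *: "(\<integral>\<^sup>+x. v x + u x \<partial>N) = (\<integral>\<^sup>+x. v x \<partial>N) + (\<integral>\<^sup>+x. u x \<partial>N)" if "N \<in> {A, B, C, D}" for N
    using that add by (auto intro!: nn_integral_add)
  show ?case using add by (simp add: *) (metis add.assoc add.commute)
next
  case (seq U)
  have mU: "U i \<in> borel_measurable N" if "N \<in> {A, B, C, D}" for N i
    using that seq(1)[of i] sets by (auto cong: measurable_cong_sets)
  have lim: "(\<lambda>i. \<integral>\<^sup>+x. U i x \<partial>N) \<longlonglongrightarrow> (\<integral>\<^sup>+x. (SUP i. U i x) \<partial>N)" if "N \<in> {A, B, C, D}" for N
  proof (rule nn_integral_LIMSEQ)
    show "incseq U" by fact
    show "\<And>i. U i \<in> borel_measurable N" using mU[OF that] .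
    show "(\<lambda>i. U i x) \<longlonglongrightarrow> (SUP i. U i x)" for x
      using \<open>incseq U\<close> by (intro LIMSEQ_SUP) (auto simp: incseq_def le_fun_def)
  qed
  have "(\<lambda>i. (\<integral>\<^sup>+x. U i x \<partial>A) + (\<integral>\<^sup>+x. U i x \<partial>B)) \<longlonglongrightarrow> (\<integral>\<^sup>+x. (SUP i. U i x) \<partial>A) + (\<integral>\<^sup>+x. (SUP i. U i x) \<partial>B)"
    by (intro tendsto_add lim) auto
  moreover have "(\<lambda>i. (\<integral>\<^sup>+x. U i x \<partial>A) + (\<integral>\<^sup>+x. U i x \<partial>B)) \<longlonglongrightarrow> (\<integral>\<^sup>+x. (SUP i. U i x) \<partial>C) + (\<integral>\<^sup>+x. (SUP i. U i x) \<partial>D)"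
    unfolding seq.IH by (intro tendsto_add lim) auto
  ultimately show ?case
    unfolding SUP_apply by (rule LIMSEQ_unique)
qed

lemma integral_add_measures:
  fixes f :: "'a \<Rightarrow> real"
  assumes fin: "finite_measure A" "finite_measure B" "finite_measure C" "finite_measure D"
    and sets: "sets B = sets A" "sets C = sets A" "sets D = sets A"
    and eq: "\<And>X. X \<in> sets A \<Longrightarrow> emeasure A X + emeasure B X = emeasure C X + emeasure D X"
    and f: "f \<in> borel_measurable A" "bounded (range f)"
  shows "(LINT x|A. f x) + (LINT x|B. f x) = (LINT x|C. f x) + (LINT x|D. f x)"
proof -
  obtain c where c: "\<And>x. norm (f x) \<le> c" using f(2) by (auto simp: bounded_iff)
  have "f \<in> borel_measurable B" "f \<in> borel_measurable C" "f \<in> borel_measurable D"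
    using f(1) sets by (simp_all cong: measurable_cong_sets)
  then have int: "integrable A f" "integrable B f" "integrable C f" "integrable D f"
    using c f(1) fin by (auto intro!: finite_measure.integrable_const_bound[where B=c])
  have e: "enn2real (x + y) = enn2real x + enn2real y" if "x \<noteq> \<infinity>" "y \<noteq> \<infinity>" for x y
    using that by (simp add: enn2real_plus less_top)
  have m: "(\<lambda>x. ennreal (f x)) \<in> borel_measurable A" "(\<lambda>x. ennreal (- f x)) \<in> borel_measurable A"
    using f(1) by measurable
  show ?thesis
    using arg_cong[OF nn_integral_add_measures[OF sets eq m(1)], of enn2real]
      arg_cong[OF nn_integral_add_measures[OF sets eq m(2)], of enn2real] int
    by (simp add: real_lebesgue_integral_def[OF int(1)] real_lebesgue_integral_def[OF int(2)]
        real_lebesgue_integral_def[OF int(3)] real_lebesgue_integral_def[OF int(4)] e real_integrable_def)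
qed

text \<open>The Jordan parts of M1 - M2 may be smaller than M1 and M2, but the positive part plus M2
  equals the negative part plus M1. Integrating this identity and rearranging gives the
  claim.\<close>

lemma signed_integral_diff:
  fixes M1 M2 :: "'a::topological_space measure"
  assumes fin: "finite_measure M1" "finite_measure M2"
    and sets: "sets M1 = sets borel" "sets M2 = sets borel"
    and f: "f \<in> borel_measurable borel" "bounded (range f)"
  shows "signed_integral (\<lambda>A. measure M1 A - measure M2 A) f = (LINT x|M1. f x) - (LINT x|M2. f x)"
proof -
  let ?d = "\<lambda>M1 M2 A. measure M1 A - measure M2 A"
  have bvm: "bounded_vector_measure (?d M1 M2)"
    if "finite_measure M1" "finite_measure M2" "sets M1 = sets borel" "sets M2 = sets borel"
    for M1 M2 :: "'a measure"
  proof (rule bounded_vector_measureI[of UNIV "\<lambda>b. if b then M1 else M2"])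
    show "norm (?d M1 M2 B) \<le> (\<Sum>b\<in>UNIV. measure (if b then M1 else M2) B)" for B
      using abs_measure_diff_le[of M1 B M2] by (simp add: UNIV_bool add.commute)
    show "(\<lambda>i. ?d M1 M2 (A i)) sums ?d M1 M2 (\<Union>i. A i)"
      if "range A \<subseteq> sets borel" "disjoint_family A" for A :: "nat \<Rightarrow> 'a set"
      using that \<open>sets M1 = sets borel\<close> \<open>sets M2 = sets borel\<close>
        \<open>finite_measure M1\<close> \<open>finite_measure M2\<close>
      by (intro sums_diff finite_measure.finite_measure_UNION) auto
  qed (use that in auto)
  \<comment> \<open>Stated for an arbitrary pair, so that exchanging M1 and M2 gives the reverse
    inequality.\<close>
  have le: "emeasure (pos_variation (?d M1 M2)) A + emeasure M2 A
      \<le> emeasure (pos_variation (?d M2 M1)) A + emeasure M1 A"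
    if fin: "finite_measure M1" "finite_measure M2"
      and sets: "sets M1 = sets borel" "sets M2 = sets borel" and A: "A \<in> sets borel"
    for M1 M2 :: "'a measure" and A
  proof -
    interpret M1: finite_measure M1 by fact
    interpret M2: finite_measure M2 by fact
    let ?B = "{B \<in> sets borel. B \<subseteq> A}"
    let ?R = "emeasure (pos_variation (?d M2 M1)) A + emeasure M1 A"
    have pos: "ennreal (?d M1 M2 B) + emeasure M2 A \<le> ?R" if B: "B \<in> ?B" "0 \<le> ?d M1 M2 B" for B
    proof -
      have "measure M1 (A - B) = measure M1 A - measure M1 B"
        using A B sets by (intro M1.finite_measure_Diff) auto
      moreover have "measure M2 (A - B) = measure M2 A - measure M2 B"
        using A B sets by (intro M2.finite_measure_Diff) auto
      \<comment> \<open>Passing from B to its complement in A turns a candidate for the positive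
        variation into one for the negative variation.\<close>
      ultimately have eq: "?d M1 M2 B + measure M2 A = ?d M2 M1 (A - B) + measure M1 A" by simp
      have "ennreal (?d M1 M2 B) + emeasure M2 A = ennreal (?d M1 M2 B + measure M2 A)"
        using B(2) by (simp add: M2.emeasure_eq_measure)
      also have "\<dots> \<le> ennreal (?d M2 M1 (A - B)) + ennreal (measure M1 A)"
        unfolding eq by (auto simp: ennreal_plus_if intro!: ennreal_leI)
      also have "\<dots> \<le> ?R"
        unfolding emeasure_pos_variation[OF bvm[OF fin(2,1) sets(2,1)] A] M1.emeasure_eq_measure
        using A B(1) by (intro add_right_mono SUP_upper) auto
      finally show ?thesis .
    qed
    have all: "ennreal (?d M1 M2 B) + emeasure M2 A \<le> ?R" if B: "B \<in> ?B" for B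
    proof (cases "0 \<le> ?d M1 M2 B")
      case False
      \<comment> \<open>\<open>ennreal\<close> truncates negative values to 0, the value of the
        empty set.\<close>
      have "ennreal (?d M1 M2 {}) + emeasure M2 A \<le> ?R" by (rule pos) auto
      with False show ?thesis by (simp add: ennreal_neg)
    qed (rule pos[OF B])
    have "?B \<noteq> {}" by auto
    then have "emeasure (pos_variation (?d M1 M2)) A + emeasure M2 A
        = (SUP B\<in>?B. ennreal (?d M1 M2 B) + emeasure M2 A)"
      unfolding emeasure_pos_variation[OF bvm[OF fin sets] A] by (simp add: ennreal_SUP_add_left)
    also have "\<dots> \<le> ?R" by (rule SUP_least[OF all])
    finally show ?thesis .
  qed
  have finp: "finite_measure (pos_variation (?d M1 M2))"
    if fin: "finite_measure M1" "finite_measure M2"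
      and sets: "sets M1 = sets borel" "sets M2 = sets borel"
    for M1 M2 :: "'a measure"
  proof (rule finite_measureI)
    interpret M1: finite_measure M1 by fact
    have U: "UNIV \<in> sets (borel :: 'a measure)" by simp
    have "emeasure (pos_variation (?d M1 M2)) UNIV \<le> emeasure M1 UNIV"
      unfolding emeasure_pos_variation[OF bvm[OF fin sets] U]
    proof (rule SUP_least)
      fix B :: "'a set"
      have "ennreal (?d M1 M2 B) \<le> emeasure M1 B"
        by (simp add: M1.emeasure_eq_measure ennreal_leI)
      also have "\<dots> \<le> emeasure M1 UNIV"
        using sets by (intro emeasure_mono) auto
      finally show "ennreal (?d M1 M2 B) \<le> emeasure M1 UNIV" .
    qed
    then show "emeasure (pos_variation (?d M1 M2)) (space (pos_variation (?d M1 M2))) \<noteq> \<infinity>"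
      by (auto simp: M1.emeasure_eq_measure top_unique)
  qed
  have "(LINT x|pos_variation (?d M1 M2). f x) + (LINT x|M2. f x)
      = (LINT x|pos_variation (?d M2 M1). f x) + (LINT x|M1. f x)"
  proof (rule integral_add_measures)
    fix X assume "X \<in> sets (pos_variation (?d M1 M2))"
    then have X: "X \<in> sets borel" by simp
    show "emeasure (pos_variation (?d M1 M2)) X + emeasure M2 X
        = emeasure (pos_variation (?d M2 M1)) X + emeasure M1 X"
      by (rule antisym[OF le[OF fin sets X] le[OF fin(2,1) sets(2,1) X]])
  next
    show "f \<in> borel_measurable (pos_variation (?d M1 M2))"
      using f(1) by (simp cong: measurable_cong_sets)
  qed (use fin sets f finp[OF fin sets] finp[OF fin(2,1) sets(2,1)] in simp_all)
  moreover have eq: "(\<lambda>A. - ?d M1 M2 A) = ?d M2 M1" by (rule ext) simp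
  ultimately show ?thesis unfolding signed_integral_def eq by linarith
qed

lemma vector_measure_of_measures:
  fixes M :: "'a::euclidean_space measure" and Q :: "'a \<Rightarrow> 'a measure"
  assumes fin: "finite_measure M" "\<And>b. finite_measure (Q b)"
    and sets: "sets M = sets borel" "\<And>b. sets (Q b) = sets borel"
  defines "\<mu> \<equiv> \<lambda>A. \<Sum>b\<in>Basis. (measure M A - measure (Q b) A) *\<^sub>R b"
  shows "bounded_vector_measure \<mu>"
    and "\<phi> \<in> borel_measurable borel \<Longrightarrow> bounded (range \<phi>) \<Longrightarrow>
      vector_integral \<mu> \<phi> = (\<Sum>b\<in>Basis. (LINT x|M. \<phi> x \<bullet> b) - (LINT x|Q b. \<phi> x \<bullet> b))"
    and "A \<in> sets borel \<Longrightarrow> emeasure M A = 0 \<Longrightarrow> (\<And>b. emeasure (Q b) A = 0) \<Longrightarrow> total_variation \<mu> A = 0"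
proof -
  \<comment> \<open>Indexing by a basis vector and a truth value lists all the dominating measures
    in one finite family.\<close>
  let ?I = "Basis \<times> (UNIV :: bool set)" and ?N = "\<lambda>(b, c). if c then M else Q b"
  have bound: "norm (\<mu> B) \<le> (\<Sum>i\<in>?I. measure (?N i) B)" for B
  proof -
    have "norm (\<mu> B) \<le> (\<Sum>b\<in>Basis. norm ((measure M B - measure (Q b) B) *\<^sub>R b))"
      unfolding \<mu>_def by (rule norm_sum)
    also have "\<dots> \<le> (\<Sum>b\<in>Basis. measure M B + measure (Q b) B)"
    proof (rule sum_mono)
      fix b :: 'a assume "b \<in> Basis"
      then show "norm ((measure M B - measure (Q b) B) *\<^sub>R b) \<le> measure M B + measure (Q b) B"
        using abs_measure_diff_le[of M B "Q b"] by simp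
    qed
    also have "\<dots> = (\<Sum>b\<in>Basis. \<Sum>c\<in>UNIV. measure (?N (b, c)) B)"
      by (simp add: UNIV_bool add.commute)
    also have "\<dots> = (\<Sum>i\<in>?I. measure (?N i) B)"
      by (subst sum.cartesian_product) (simp add: case_prod_unfold cong: if_cong)
    finally show ?thesis .
  qed
  have N: "finite_measure (?N i)" "sets (?N i) = sets borel" for i
    using fin sets by (auto split: prod.split)
  show "bounded_vector_measure \<mu>"
  proof (rule bounded_vector_measureI[of ?I ?N, OF _ N bound])
    show "(\<lambda>i. \<mu> (A i)) sums \<mu> (\<Union>i. A i)"
      if "range A \<subseteq> sets borel" "disjoint_family A" for A :: "nat \<Rightarrow> 'a set"
      unfolding \<mu>_def using that fin sets
      by (intro sums_sum bounded_linear.sums[OF bounded_linear_scaleR_left] sums_diff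
          finite_measure.finite_measure_UNION) auto
  qed simp
  show "total_variation \<mu> A = 0"
    if A: "A \<in> sets borel" "emeasure M A = 0" "\<And>b. emeasure (Q b) A = 0"
  proof -
    have "(\<Sum>i\<in>?I. emeasure (?N i) A) = 0" using A by (intro sum.neutral) auto
    then show ?thesis using total_variation_le[of ?I ?N, OF N bound A(1)] by (simp only: le_zero_eq)
  qed
  show "vector_integral \<mu> \<phi> = (\<Sum>b\<in>Basis. (LINT x|M. \<phi> x \<bullet> b) - (LINT x|Q b. \<phi> x \<bullet> b))"
    if \<phi>: "\<phi> \<in> borel_measurable borel" "bounded (range \<phi>)"
    unfolding vector_integral_def
  proof (rule sum.cong[OF refl])
    fix b :: 'a assume b: "b \<in> Basis"
    have "(\<lambda>A. \<mu> A \<bullet> b) = (\<lambda>A. measure M A - measure (Q b) A)"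
      unfolding \<mu>_def using b by (simp add: inner_sum_left_Basis)
    moreover have "bounded (range (\<lambda>x. \<phi> x \<bullet> b))"
      using bounded_linear_image[OF \<phi>(2) bounded_linear_inner_left, of b] by (simp add: image_image)
    ultimately show "signed_integral (\<lambda>A. \<mu> A \<bullet> b) (\<lambda>x. \<phi> x \<bullet> b)
        = (LINT x|M. \<phi> x \<bullet> b) - (LINT x|Q b. \<phi> x \<bullet> b)"
      using signed_integral_diff[OF fin(1) fin(2)[of b] sets(1) sets(2)[of b], of "\<lambda>x. \<phi> x \<bullet> b"] \<phi>(1)
      by simp
  qed
qed

section \<open>Shape derivatives\<close>

text \<open>On the reduced boundary the limit exists and has norm 1, so \<open>Lim\<close> returns
  it and not an arbitrary value.\<close>

lemma norm_measure_normal_le: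
  assumes "x \<in> reduced_boundary E"
  shows "norm (measure_normal E x) \<le> 1"
proof -
  obtain \<nu> where \<nu>: "norm \<nu> = 1" "(normal_quotient E x \<longlongrightarrow> \<nu>) (at_right 0)"
    using assms by (auto simp: reduced_boundary_def)
  have "measure_normal E x = \<nu>"
    unfolding measure_normal_def by (rule tendsto_Lim[OF _ \<nu>(2)]) simp
  then show ?thesis using \<nu>(1) by simp
qed

lemma abs_inner_normal_le:
  assumes "norm v \<le> B" "x \<in> reduced_boundary E"
  shows "\<bar>v \<bullet> measure_normal E x\<bar> \<le> B"
proof -
  have "\<bar>v \<bullet> measure_normal E x\<bar> \<le> norm v * norm (measure_normal E x)"
    by (rule Cauchy_Schwarz_ineq2)
  also have "\<dots> \<le> norm v * 1"
    using norm_measure_normal_le[OF assms(2)] by (intro mult_left_mono) auto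
  finally show ?thesis using assms(1) by simp
qed

text \<open>A bound valid for every admissible c passes to the infimum. Nonemptiness of the
  admissible set matters, as the infimum of the empty set carries no information; it holds because
  xi is bounded and the normal has norm at most 1.\<close>

lemma Linf_normE:
  fixes \<xi> :: "'a::euclidean_space Theta"
  assumes "\<And>c. 0 \<le> c \<Longrightarrow> AE x\<in>reduced_boundary E in M. \<bar>apply_Theta \<xi> x \<bullet> measure_normal E x\<bar> \<le> c \<Longrightarrow> a \<le> k * c"
    and "0 \<le> k"
  shows "a \<le> k * Linf_norm (reduced_boundary E) M (\<lambda>x. apply_Theta \<xi> x \<bullet> measure_normal E x)"
proof -
  let ?C = "{c. 0 \<le> c \<and> (AE x\<in>reduced_boundary E in M. \<bar>apply_Theta \<xi> x \<bullet> measure_normal E x\<bar> \<le> c)}"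
  obtain B where B: "0 < B" "\<And>x. norm (apply_Theta \<xi> x) \<le> B"
    using bounded_range_apply_Theta[of \<xi>] by (auto simp: bounded_pos)
  have BC: "B \<in> ?C" using B(1) abs_inner_normal_le[OF B(2)] by simp
  show ?thesis
  proof (cases "k = 0")
    \<comment> \<open>Division by k is impossible here; a single admissible c suffices.\<close>
    case True
    then show ?thesis using assms(1)[of B] BC by simp
  next
    case False
    with assms(2) have k: "0 < k" by simp
    have "a / k \<le> Inf ?C"
      using BC assms(1) k by (intro cInf_greatest) (auto simp: pos_divide_le_eq mult.commute)
    then show ?thesis using k by (simp add: Linf_norm_def pos_divide_le_eq mult.commute)
  qed
qed

section \<open>Bounds for a positive shape derivative\<close>

context
  fixes E :: "'a::euclidean_space set" and J :: "'a set \<Rightarrow> real" and J' :: "'a Theta \<Rightarrow> real"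
    and H :: "'a measure" and \<xi>\<^sub>0 :: "'a Theta" and \<eta> :: real
  assumes J': "((\<lambda>\<theta>. J (deform \<theta> E)) has_derivative J') (at 0)"
    and pos: "\<And>\<xi>. AE x\<in>reduced_boundary E in H. 0 \<le> apply_Theta \<xi> x \<bullet> measure_normal E x \<Longrightarrow> 0 \<le> J' \<xi>"
    and \<eta>: "0 < \<eta>" "AE x\<in>reduced_boundary E in H. \<eta> \<le> apply_Theta \<xi>\<^sub>0 x \<bullet> measure_normal E x"
begin

lemma linear_J': "linear J'"
  using J' by (rule has_derivative_linear)

lemma transversal_field_ge_0: "0 \<le> J' \<xi>\<^sub>0"
  by (rule pos) (use \<eta> in \<open>auto elim: AE_mp\<close>)

lemma shape_derivative_le_Linf_norm:
  "\<bar>J' \<xi>\<bar> \<le> J' \<xi>\<^sub>0 / \<eta> * Linf_norm (reduced_boundary E) H (\<lambda>x. apply_Theta \<xi> x \<bullet> measure_normal E x)"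
proof (rule Linf_normE)
  fix c assume c: "0 \<le> c" "AE x\<in>reduced_boundary E in H. \<bar>apply_Theta \<xi> x \<bullet> measure_normal E x\<bar> \<le> c"
  \<comment> \<open>The first summand has normal component at least c and absorbs that of s xi; s =
    1 and s = -1 give the two sides of the bound.\<close>
  have *: "0 \<le> J' ((c / \<eta>) *\<^sub>R \<xi>\<^sub>0 + s *\<^sub>R \<xi>)" if "\<bar>s\<bar> = 1" for s
  proof (rule pos)
    show "AE x\<in>reduced_boundary E in H. 0 \<le> apply_Theta ((c / \<eta>) *\<^sub>R \<xi>\<^sub>0 + s *\<^sub>R \<xi>) x \<bullet> measure_normal E x"
      using c(2) \<eta>(2)
    proof eventually_elim
      case (elim x)
      show ?case
      proof
        assume x: "x \<in> reduced_boundary E"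
        let ?u = "apply_Theta \<xi>\<^sub>0 x \<bullet> measure_normal E x" and ?v = "apply_Theta \<xi> x \<bullet> measure_normal E x"
        have "c / \<eta> * \<eta> \<le> c / \<eta> * ?u" using elim x c(1) \<eta>(1) by (intro mult_left_mono) auto
        moreover have "\<bar>s * ?v\<bar> \<le> c" using elim x that by (simp add: abs_mult)
        ultimately show "0 \<le> apply_Theta ((c / \<eta>) *\<^sub>R \<xi>\<^sub>0 + s *\<^sub>R \<xi>) x \<bullet> measure_normal E x"
          using \<eta>(1) by (simp add: inner_add_left)
      qed
    qed
  qed
  have lin: "J' ((c / \<eta>) *\<^sub>R \<xi>\<^sub>0 + s *\<^sub>R \<xi>) = c / \<eta> * J' \<xi>\<^sub>0 + s * J' \<xi>" for s
    using linear_J' by (simp add: linear_add linear_cmul)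
  have "0 \<le> c / \<eta> * J' \<xi>\<^sub>0 + 1 * J' \<xi>" "0 \<le> c / \<eta> * J' \<xi>\<^sub>0 + (- 1) * J' \<xi>"
    unfolding lin[symmetric] by (intro *, simp)+
  then show "\<bar>J' \<xi>\<bar> \<le> J' \<xi>\<^sub>0 / \<eta> * c"
    by (simp add: abs_le_iff mult.commute)
next
  show "0 \<le> J' \<xi>\<^sub>0 / \<eta>" using transversal_field_ge_0 \<eta>(1) by simp
qed

text \<open>The normal has norm at most 1, so the sup norm is admissible in
  \<open>Linf_norm\<close>. The factor does not depend on the support, which yields order 0 with one
  constant for all compact sets.\<close>

lemma shape_derivative_le_sup_norm:
  "\<bar>J' \<xi>\<bar> \<le> J' \<xi>\<^sub>0 / \<eta> * (SUP x. norm (apply_Theta \<xi> x))"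
proof -
  let ?s = "SUP x. norm (apply_Theta \<xi> x)"
  have bdd: "bdd_above (range (\<lambda>x. norm (apply_Theta \<xi> x)))"
    using bounded_range_apply_Theta[of \<xi>] by (auto simp: bounded_iff bdd_above_def)
  have le: "norm (apply_Theta \<xi> x) \<le> ?s" for x by (rule cSUP_upper[OF _ bdd]) simp
  then have s0: "0 \<le> ?s" using norm_ge_zero order_trans by blast
  let ?C = "{c. 0 \<le> c \<and> (AE x\<in>reduced_boundary E in H. \<bar>apply_Theta \<xi> x \<bullet> measure_normal E x\<bar> \<le> c)}"
  have "?s \<in> ?C" using s0 abs_inner_normal_le[OF le] by simp
  then have "Linf_norm (reduced_boundary E) H (\<lambda>x. apply_Theta \<xi> x \<bullet> measure_normal E x) \<le> ?s"
    unfolding Linf_norm_def by (intro cInf_lower) (auto simp: bdd_below_def)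
  then have "J' \<xi>\<^sub>0 / \<eta> * Linf_norm (reduced_boundary E) H (\<lambda>x. apply_Theta \<xi> x \<bullet> measure_normal E x)
      \<le> J' \<xi>\<^sub>0 / \<eta> * ?s"
    using transversal_field_ge_0 \<eta>(1) by (intro mult_left_mono) auto
  then show ?thesis using shape_derivative_le_Linf_norm[of \<xi>] by linarith
qed

lemma restriction_of_order_0: "distribution_of_order_0 (restrict_to_test_fields J')"
  unfolding distribution_of_order_0_def
proof (intro conjI allI impI)
  fix \<phi> \<psi> :: "'a \<Rightarrow> 'a" and a b
  assume "test_field \<phi>" "test_field \<psi>"
  then have mem: "\<phi> \<in> C1_bounded" "\<psi> \<in> C1_bounded" by (auto intro: test_field_C1_bounded)
  have "Abs_Theta (\<lambda>x. a *\<^sub>R \<phi> x + b *\<^sub>R \<psi> x) = a *\<^sub>R Abs_Theta \<phi> + b *\<^sub>R Abs_Theta \<psi>"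
    by (rule Theta_eqI) (simp add: Abs_Theta_inverse mem C1_bounded_lincomb)
  then show "restrict_to_test_fields J' (\<lambda>x. a *\<^sub>R \<phi> x + b *\<^sub>R \<psi> x)
      = a * restrict_to_test_fields J' \<phi> + b * restrict_to_test_fields J' \<psi>"
    using linear_J' by (simp add: restrict_to_test_fields_def linear_add linear_cmul)
next
  fix K :: "'a set"
  show "\<exists>C. \<forall>\<phi>. test_field \<phi> \<longrightarrow> (\<forall>x. x \<notin> K \<longrightarrow> \<phi> x = 0) \<longrightarrow>
      \<bar>restrict_to_test_fields J' \<phi>\<bar> \<le> C * (SUP x. norm (\<phi> x))"
  proof (intro exI[of _ "J' \<xi>\<^sub>0 / \<eta>"] allI impI)
    fix \<phi> :: "'a \<Rightarrow> 'a" assume "test_field \<phi>"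
    then have "apply_Theta (Abs_Theta \<phi>) = \<phi>"
      by (simp add: Abs_Theta_inverse test_field_C1_bounded)
    then show "\<bar>restrict_to_test_fields J' \<phi>\<bar> \<le> J' \<xi>\<^sub>0 / \<eta> * (SUP x. norm (\<phi> x))"
      using shape_derivative_le_sup_norm[of "Abs_Theta \<phi>"] by (simp add: restrict_to_test_fields_def)
  qed
qed

section \<open>The representing vector measure on the frontier\<close>

text \<open>A nonnegative multiplier f preserves the sign of the normal component, so the functional
  is positive. If f vanishes on the frontier, so does f zeta, and
  \<open>shape_derivative_eq_0\<close> excludes mass on the open complement.\<close>

lemma measure_of_field:
  assumes \<zeta>: "AE x\<in>reduced_boundary E in H. 0 \<le> apply_Theta \<zeta> x \<bullet> measure_normal E x"
  shows "\<exists>M. represented_by (\<lambda>f. J' (Abs_Theta (\<lambda>x. f x *\<^sub>R apply_Theta \<zeta> x))) M \<and>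
    emeasure M (- frontier E) = 0"
proof -
  define m where "m f = Abs_Theta (\<lambda>x. f x *\<^sub>R apply_Theta \<zeta> x)" for f
  have m: "apply_Theta (m f) x = f x *\<^sub>R apply_Theta \<zeta> x" if "C1b f" for f x
    unfolding m_def by (simp add: apply_Abs_Theta C1b_scaleR that C1b_Theta)
  have "\<exists>M. represented_by (\<lambda>f. J' (m f)) M \<and> emeasure M (- frontier E) = 0"
  proof (rule C1b_measure_representation)
    fix f g :: "'a \<Rightarrow> real" assume fg: "C1b f" "C1b g"
    have "m (\<lambda>x. f x + g x) = m f + m g"
      by (rule Theta_eqI) (simp add: m fg C1b_add scaleR_add_left)
    then show "J' (m (\<lambda>x. f x + g x)) = J' (m f) + J' (m g)"
      using linear_J' by (simp add: linear_add)
  next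
    fix f :: "'a \<Rightarrow> real" and c assume f: "C1b f"
    have "m (\<lambda>x. c * f x) = c *\<^sub>R m f"
      by (rule Theta_eqI) (simp add: m f C1b_mult C1b_const)
    then show "J' (m (\<lambda>x. c * f x)) = c * J' (m f)"
      using linear_J' by (simp add: linear_cmul)
  next
    fix f :: "'a \<Rightarrow> real" assume f: "C1b f" "\<And>x. 0 \<le> f x"
    show "0 \<le> J' (m f)"
    proof (rule pos)
      show "AE x\<in>reduced_boundary E in H. 0 \<le> apply_Theta (m f) x \<bullet> measure_normal E x"
        using \<zeta> by eventually_elim (simp add: m f)
    qed
  next
    show "open (- frontier E)" by (simp add: open_Compl)
  next
    fix f :: "'a \<Rightarrow> real" assume f: "C1b f" "\<And>x. x \<notin> - frontier E \<Longrightarrow> f x = 0"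
    show "J' (m f) = 0"
      by (rule shape_derivative_eq_0[OF J']) (use f in \<open>simp add: m\<close>)
  qed
  then show ?thesis unfolding m_def .
qed

lemma shape_derivative_measure:
  "\<exists>\<mu>. bounded_vector_measure \<mu> \<and>
      (\<forall>\<phi>. test_field \<phi> \<longrightarrow> restrict_to_test_fields J' \<phi> = vector_integral \<mu> \<phi>) \<and>
      total_variation \<mu> (- frontier E) = 0"
proof -
  \<comment> \<open>After rescaling the normal component is at least 1, enough to absorb that of any
    b with norm at most 1.\<close>
  define \<zeta> where "\<zeta> = (1 / \<eta>) *\<^sub>R \<xi>\<^sub>0"
  define \<beta> where "\<beta> b = (Abs_Theta (\<lambda>x. b) :: 'a Theta)" for b
  have \<beta>: "apply_Theta (\<beta> b) x = b" for b x
    by (simp add: \<beta>_def apply_Abs_Theta C1b_const)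
  have ge1: "AE x\<in>reduced_boundary E in H. 1 \<le> apply_Theta \<zeta> x \<bullet> measure_normal E x"
    using \<eta>(2) by eventually_elim (use \<eta>(1) in \<open>simp add: \<zeta>_def field_simps\<close>)
  have \<zeta>0: "AE x\<in>reduced_boundary E in H. 0 \<le> apply_Theta \<zeta> x \<bullet> measure_normal E x"
    using ge1 by eventually_elim auto
  have \<zeta>b: "AE x\<in>reduced_boundary E in H. 0 \<le> apply_Theta (\<zeta> - \<beta> b) x \<bullet> measure_normal E x"
    if "norm b \<le> 1" for b
    using ge1
  proof eventually_elim
    case (elim x)
    show ?case
    proof
      assume x: "x \<in> reduced_boundary E"
      have "b \<bullet> measure_normal E x \<le> norm b * norm (measure_normal E x)" by (rule norm_cauchy_schwarz)
      also have "\<dots> \<le> 1" using that norm_measure_normal_le[OF x] by (intro mult_le_one) auto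
      finally show "0 \<le> apply_Theta (\<zeta> - \<beta> b) x \<bullet> measure_normal E x"
        using elim x by (simp add: \<beta> inner_diff_left)
    qed
  qed
  define rep where "rep \<zeta> M \<longleftrightarrow>
      represented_by (\<lambda>f. J' (Abs_Theta (\<lambda>x. f x *\<^sub>R apply_Theta \<zeta> x))) M \<and> emeasure M (- frontier E) = 0"
    for \<zeta> M
  obtain M where M: "rep \<zeta> M"
    using measure_of_field[OF \<zeta>0] unfolding rep_def by (rule exE)
  have "\<forall>b. \<exists>N. norm b \<le> 1 \<longrightarrow> rep (\<zeta> - \<beta> b) N"
    using measure_of_field[OF \<zeta>b] unfolding rep_def by simp
  then obtain Q' where Q': "\<forall>b. norm b \<le> 1 \<longrightarrow> rep (\<zeta> - \<beta> b) (Q' b)"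
    unfolding choice_iff by (rule exE)
  \<comment> \<open>Outside the unit ball M is a default that keeps every \<open>Q b\<close> a
    finite measure, as \<open>vector_measure_of_measures\<close> demands; basis vectors lie in the
    ball.\<close>
  define Q where "Q b = (if norm b \<le> 1 then Q' b else M)" for b
  have M1: "finite_measure M" "sets M = sets borel" "emeasure M (- frontier E) = 0"
    using M by (simp_all add: rep_def represented_by_def)
  have Q1: "finite_measure (Q b)" "sets (Q b) = sets borel" "emeasure (Q b) (- frontier E) = 0" for b
    using M1 Q' by (simp_all add: Q_def rep_def represented_by_def)
  define \<mu> where "\<mu> = (\<lambda>A. \<Sum>b\<in>Basis. (measure M A - measure (Q b) A) *\<^sub>R b)"
  note measures = M1(1) Q1(1) M1(2) Q1(2)
  have "restrict_to_test_fields J' \<phi> = vector_integral \<mu> \<phi>" if \<phi>: "test_field \<phi>" for \<phi>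
  proof -
    obtain K where K: "compact K" "\<forall>x. x \<notin> K \<longrightarrow> \<phi> x = 0"
      using \<phi> by (auto simp: test_field_def)
    have C: "C1b \<phi>" using test_field_C1_bounded[OF \<phi>] by (simp add: C1b_iff_C1_bounded)
    define f where "f b = (\<lambda>x. \<phi> x \<bullet> b)" for b
    define F where "F b = Abs_Theta (\<lambda>x. f b x *\<^sub>R b)" for b
    have f: "C1b (f b)" for b unfolding f_def by (intro C1b_inner C C1b_const)
    have F: "apply_Theta (F b) x = f b x *\<^sub>R b" for b x
      unfolding F_def by (simp add: apply_Abs_Theta C1b_scaleR f C1b_const)
    have comp: "(LINT x|M. f b x) - (LINT x|Q b. f b x) = J' (F b)" if b: "b \<in> Basis" for b
    proof -
      have fK: "\<forall>x. x \<notin> K \<longrightarrow> f b x = 0" using K(2) by (simp add: f_def)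
      have fz: "apply_Theta (Abs_Theta (\<lambda>x. f b x *\<^sub>R apply_Theta z x)) x = f b x *\<^sub>R apply_Theta z x" for z x
        by (simp only: apply_Abs_Theta[OF C1b_scaleR[OF f C1b_Theta]])
      \<comment> \<open>The field in direction b is the difference of the multiples of zeta and zeta
        - b by the same scalar, and each has a representing measure.\<close>
      have "F b = Abs_Theta (\<lambda>x. f b x *\<^sub>R apply_Theta \<zeta> x)
          - Abs_Theta (\<lambda>x. f b x *\<^sub>R apply_Theta (\<zeta> - \<beta> b) x)"
        by (rule Theta_eqI, subst minus_Theta.rep_eq, subst fz, subst fz) (simp add: F \<beta> scaleR_diff_right)
      then have "J' (F b) = J' (Abs_Theta (\<lambda>x. f b x *\<^sub>R apply_Theta \<zeta> x))
          - J' (Abs_Theta (\<lambda>x. f b x *\<^sub>R apply_Theta (\<zeta> - \<beta> b) x))"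
        by (simp only: linear_diff[OF linear_J'])
      also have "J' (Abs_Theta (\<lambda>x. f b x *\<^sub>R apply_Theta \<zeta> x)) = (LINT x|M. f b x)"
        using M f[of b] K(1) fK unfolding rep_def represented_by_def by (elim conjE) simp
      also have "J' (Abs_Theta (\<lambda>x. f b x *\<^sub>R apply_Theta (\<zeta> - \<beta> b) x)) = (LINT x|Q b. f b x)"
        using Q' f[of b] K(1) fK b unfolding rep_def represented_by_def Q_def
        by (simp del: minus_Theta.rep_eq apply_Theta_simps)
      finally show ?thesis by simp
    qed
    have sumF: "apply_Theta (\<Sum>b\<in>B. F b) x = (\<Sum>b\<in>B. f b x *\<^sub>R b)" if "finite B" for B x
      using that by induction (simp_all add: F)
    have "Abs_Theta \<phi> = (\<Sum>b\<in>Basis. F b)"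
      by (rule Theta_eqI) (simp add: sumF apply_Abs_Theta C f_def euclidean_representation)
    then have "restrict_to_test_fields J' \<phi> = (\<Sum>b\<in>Basis. J' (F b))"
      using linear_sum[OF linear_J'] by (simp add: restrict_to_test_fields_def)
    also have "\<dots> = (\<Sum>b\<in>Basis. (LINT x|M. \<phi> x \<bullet> b) - (LINT x|Q b. \<phi> x \<bullet> b))"
      using comp by (intro sum.cong) (auto simp: f_def)
    also have "\<dots> = vector_integral \<mu> \<phi>"
      unfolding \<mu>_def
      by (rule vector_measure_of_measures(2)[OF measures, symmetric]) (use C in \<open>auto intro: borel_measurable_continuous_onI C1b_continuous C1b_bounded\<close>)
    finally show ?thesis .
  qed
  moreover have "total_variation \<mu> (- frontier E) = 0"
    unfolding \<mu>_def by (rule vector_measure_of_measures(3)[OF measures]) (use M1(3) Q1(3) in \<open>simp_all add: frontier_closed open_Compl\<close>)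
  moreover have "bounded_vector_measure \<mu>"
    unfolding \<mu>_def by (rule vector_measure_of_measures(1)[OF measures])
  ultimately show ?thesis by (intro exI[of _ \<mu>]) simp
qed

end

section \<open>The structure of a positive shape derivative\<close>

theorem proposition3p2:
  fixes E :: "(real ^ 'n) set"
    and J :: "(real ^ 'n) set \<Rightarrow> real"
    and J' :: "(real ^ 'n) Theta \<Rightarrow> real"
  assumes "finite_perimeter E"
    and "\<exists>\<xi>\<^sub>0 :: (real ^ 'n) Theta. \<exists>\<eta>>0.
           AE x\<in>reduced_boundary E in hausdorff_measure (CARD('n) - 1).
             apply_Theta \<xi>\<^sub>0 x \<bullet> measure_normal E x \<ge> \<eta>"
    and "((\<lambda>\<theta>. J (deform \<theta> E)) has_derivative J') (at 0)"
    and "\<exists>\<delta>>0. \<forall>\<theta>\<^sub>1 \<theta>\<^sub>2. norm \<theta>\<^sub>1 < \<delta> \<longrightarrow> norm \<theta>\<^sub>2 < \<delta> \<longrightarrow>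
           sym_diff (deform \<theta>\<^sub>1 E) (deform \<theta>\<^sub>2 E) \<in> null_sets lebesgue \<longrightarrow>
           J (deform \<theta>\<^sub>1 E) = J (deform \<theta>\<^sub>2 E)"
    and "\<forall>\<xi>. (AE x\<in>reduced_boundary E in hausdorff_measure (CARD('n) - 1).
                apply_Theta \<xi> x \<bullet> measure_normal E x \<ge> 0) \<longrightarrow> J' \<xi> \<ge> 0"
  shows "(\<exists>k\<ge>0. \<forall>\<xi>. \<bar>J' \<xi>\<bar> \<le>
            k * Linf_norm (reduced_boundary E) (hausdorff_measure (CARD('n) - 1))
                  (\<lambda>x. apply_Theta \<xi> x \<bullet> measure_normal E x)) \<and>
         distribution_of_order_0 (restrict_to_test_fields J') \<and>
         (\<exists>\<mu> :: (real ^ 'n) set \<Rightarrow> real ^ 'n. bounded_vector_measure \<mu> \<and>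
            (\<forall>\<phi>. test_field \<phi> \<longrightarrow> restrict_to_test_fields J' \<phi> = vector_integral \<mu> \<phi>) \<and>
            total_variation \<mu> (- frontier E) = 0)"
proof -
  let ?H = "hausdorff_measure (CARD('n) - 1) :: (real ^ 'n) measure"
  obtain \<xi>\<^sub>0 \<eta> where \<eta>: "0 < \<eta>"
    "AE x\<in>reduced_boundary E in ?H. \<eta> \<le> apply_Theta \<xi>\<^sub>0 x \<bullet> measure_normal E x"
    using assms(2) by blast
  note hyps = assms(3) assms(5)[rule_format] \<eta>
  show ?thesis
  proof (intro conjI)
    show "\<exists>k\<ge>0. \<forall>\<xi>. \<bar>J' \<xi>\<bar> \<le> k * Linf_norm (reduced_boundary E) ?H (\<lambda>x. apply_Theta \<xi> x \<bullet> measure_normal E x)"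
      \<comment> \<open>The constant is \<open>J' \<xi>\<^sub>0 / \<eta>\<close>, nonnegative since
        \<open>\<xi>\<^sub>0\<close> itself has nonnegative normal component.\<close>
      using shape_derivative_le_Linf_norm[OF hyps] transversal_field_ge_0[OF hyps] \<eta>(1)
      by (intro exI[of _ "J' \<xi>\<^sub>0 / \<eta>"]) simp
    show "distribution_of_order_0 (restrict_to_test_fields J')"
      by (rule restriction_of_order_0[OF hyps])
    show "\<exists>\<mu> :: (real ^ 'n) set \<Rightarrow> real ^ 'n. bounded_vector_measure \<mu> \<and>
        (\<forall>\<phi>. test_field \<phi> \<longrightarrow> restrict_to_test_fields J' \<phi> = vector_integral \<mu> \<phi>) \<and>
        total_variation \<mu> (- frontier E) = 0"
      by (rule shape_derivative_measure[OF hyps])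
  qed
qed

end
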